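(* For non-zero integers $a,b,c$ let $\rho(B;a,b,c)$ be the number of integer triples $(x,y,z)$ with $ax^3+by^3+cz^3=0$, $\gcd(x,y,z)=1$ and $\max(|x|,|y|,|z|)\le B$. Then for any $\varepsilon>0$, \[\rho(B;a,b,c)\ll_\varepsilon B^\varepsilon,\] uniformly for all non-zero integers $a,b,c$ (the implied constant depends only on $\varepsilon$). *)

theory Defs
  imports Complex_Main
begin

definition rho :: "real \<Rightarrow> int \<Rightarrow> int \<Rightarrow> int \<Rightarrow> nat" where
  "rho B a b c = card {(x::int, y::int, z::int).
      a * x ^ 3 + b * y ^ 3 + c * z ^ 3 = 0 \<and> gcd x (gcd y z) = 1 \<and>
      real_of_int (max \<bar>x\<bar> (max \<bar>y\<bar> \<bar>z\<bar>)) \<le> B}"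

end

theory Submission
  imports Defs "HOL-Computational_Algebra.Computational_Algebra"
begin

text \<open>
  Work over the Eisenstein integers and perform a descent along multiplication by \<open>\<surd>-3\<close>. Let
  \<open>X(H)\<close> be the points of \<open>p\<^sup>3 + q\<^sup>3 = N t\<^sup>3\<close> of height at most \<open>H\<close>. The three linear factors of \<open>p\<^sup>3 + q\<^sup>3\<close> sum to
  zero after scaling by roots of unity, and up to primes dividing \<open>3N\<close> they are cubes, so \<open>X(H)\<close> splits into
  \<open>O(|N|\<^sup>\<eta>)\<close> classes, each parametrised by a curve \<open>a x\<^sup>3 + b y\<^sup>3 + c z\<^sup>3 = 0\<close>. Fix a reference point \<open>R\<close> in a class.
  For \<open>P\<close> in the same class the three points \<open>P - \<omega>\<^sup>i R\<close> are all divisible by \<open>\<surd>-3\<close>; as \<open>\<Sum>\<^sub>i \<omega>\<^sup>i R = 0\<close>, the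
  parallelogram law makes the sum of their heights \<open>3 h(P) + 3 h(R)\<close>, so after division by \<open>\<surd>-3\<close> one of them has
  height at most \<open>(h(P) + h(R)) / 3\<close>. This point recovers \<open>P\<close> up to boundedly many choices,
  whence \<open>#X(H) \<lless> |N|\<^bsup>3\<eta>\<^esup> (1 + #X(55 H\<^bsup>2/3\<^esup>))\<close>. A number of steps depending only on \<open>\<epsilon>\<close>, followed by the trivial
  bound \<open>#X(H) \<lless> H\<^sup>4\<close>, suffices, because \<open>a, b, c\<close> may be assumed to be at most \<open>2 B\<^sup>6\<close>.
\<close>

section \<open>Eisenstein integers\<close>

definition w3 :: complex where "w3 = Complex (-1/2) (sqrt 3 / 2)"

lemma w3_sq: "w3 * w3 = - 1 - w3"
  by (simp add: w3_def complex_eq_iff field_simps)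

text \<open>Realising the ring inside the complex numbers lets the ring laws be inherited by
  transfer and supplies an absolute value through \<open>toC\<close>.\<close>

typedef eis = "{z. \<exists>a b::int. z = of_int a + of_int b * w3}"
  morphisms toC Abs_eis by blast

setup_lifting type_definition_eis

lemma eis_mult_closed:
  "(of_int a + of_int b * w3) * (of_int c + of_int d * w3)
    = of_int (a * c - b * d) + of_int (a * d + b * c - b * d) * w3"
proof -
  have "(of_int a + of_int b * w3) * (of_int c + of_int d * w3)
    = of_int a * of_int c + (of_int a * of_int d + of_int b * of_int c) * w3
      + of_int b * of_int d * (w3 * w3)"
    by (simp add: algebra_simps)
  then show ?thesis by (simp add: w3_sq algebra_simps)
qed

instantiation eis :: idom
begin

lift_definition zero_eis :: eis is 0 by (intro exI[of _ 0]) simp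
lift_definition one_eis :: eis is 1 by (rule exI[of _ 1], rule exI[of _ 0]) simp
lift_definition uminus_eis :: "eis \<Rightarrow> eis" is uminus
proof (elim exE)
  fix z a b assume "z = of_int a + of_int b * w3"
  then have "- z = of_int (-a) + of_int (-b) * w3" by simp
  then show "\<exists>a b. - z = of_int a + of_int b * w3" by blast
qed
lift_definition plus_eis :: "eis \<Rightarrow> eis \<Rightarrow> eis" is plus
proof (elim exE)
  fix z y a b c d
  assume "z = of_int a + of_int b * w3" "y = of_int c + of_int d * w3"
  then have "z + y = of_int (a + c) + of_int (b + d) * w3" by (simp add: algebra_simps)
  then show "\<exists>a b. z + y = of_int a + of_int b * w3" by blast
qed
lift_definition minus_eis :: "eis \<Rightarrow> eis \<Rightarrow> eis" is minus
proof (elim exE)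
  fix z y a b c d
  assume "z = of_int a + of_int b * w3" "y = of_int c + of_int d * w3"
  then have "z - y = of_int (a - c) + of_int (b - d) * w3" by (simp add: algebra_simps)
  then show "\<exists>a b. z - y = of_int a + of_int b * w3" by blast
qed
lift_definition times_eis :: "eis \<Rightarrow> eis \<Rightarrow> eis" is times
  using eis_mult_closed by blast

instance
  by intro_classes (transfer; simp add: algebra_simps)+

end

lift_definition \<omega> :: eis is w3 by (rule exI[of _ 0], rule exI[of _ 1]) simp

lemma toC_simps [simp]:
  "toC 0 = 0" "toC 1 = 1" "toC (- x) = - toC x" "toC (x + y) = toC x + toC y"
  "toC (x - y) = toC x - toC y" "toC (x * y) = toC x * toC y"
  by (transfer; simp)+

lemma toC_power [simp]: "toC (x ^ n) = toC x ^ n"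
  by (induction n) simp_all

lemma toC_of_nat [simp]: "toC (of_nat n) = of_nat n"
  by (induction n) simp_all

lemma toC_of_int [simp]: "toC (of_int n) = of_int n"
  by (cases n) simp_all

lemma toC_numeral [simp]: "toC (numeral n) = numeral n"
  using toC_of_nat[of "numeral n"] by simp

lemma toC_prod [simp]: "toC (prod f A) = (\<Prod>x\<in>A. toC (f x))"
  by (induction A rule: infinite_finite_induct) simp_all

lemma toC_eq_iff [simp]: "toC x = toC y \<longleftrightarrow> x = y"
  by (simp add: toC_inject)

lemma toC_eq_0_iff [simp]: "toC x = 0 \<longleftrightarrow> x = 0"
  using toC_eq_iff[of x 0] by simp

instance eis :: ring_char_0
proof
  show "inj (of_nat :: nat \<Rightarrow> eis)"
    by (rule injI) (metis of_nat_eq_iff toC_of_nat)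
qed

lemma omega_sq: "\<omega> * \<omega> = - 1 - \<omega>"
  by transfer (rule w3_sq)

lemma eis_cases: obtains a b :: int where "z = of_int a + of_int b * \<omega>"
proof -
  obtain a b where "toC z = of_int a + of_int b * w3" using toC[of z] by blast
  then have "toC z = toC (of_int a + of_int b * \<omega>)" by (simp add: \<omega>.rep_eq)
  then show ?thesis by (intro that) (simp only: toC_eq_iff)
qed

lemma norm_lattice_sq:
  fixes r s :: real
  shows "(cmod (of_real r + of_real s * w3))\<^sup>2 = r\<^sup>2 - r * s + s\<^sup>2"
  unfolding cmod_power2 by (simp add: w3_def power2_eq_square field_simps)

section \<open>Norm, Euclidean division and gcds\<close>

definition eisnorm :: "eis \<Rightarrow> nat" where
  "eisnorm z = nat \<lfloor>(cmod (toC z))\<^sup>2\<rfloor>"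

lemma eisnorm_eq: "real (eisnorm z) = (cmod (toC z))\<^sup>2"
proof -
  obtain a b :: int where z: "z = of_int a + of_int b * \<omega>" by (rule eis_cases)
  define n where "n = a\<^sup>2 - a * b + b\<^sup>2"
  have n: "(cmod (toC z))\<^sup>2 = of_int n"
    using norm_lattice_sq[of "of_int a" "of_int b"] by (simp add: n_def z \<omega>.rep_eq)
  then have "n \<ge> 0" by (metis of_int_0_le_iff zero_le_power2)
  then show ?thesis unfolding eisnorm_def n by simp
qed

lemma eisnorm_0_iff [simp]: "eisnorm z = 0 \<longleftrightarrow> z = 0"
proof -
  have "eisnorm z = 0 \<longleftrightarrow> real (eisnorm z) = 0" by simp
  then show ?thesis unfolding eisnorm_eq by simp
qed

lemma eisnorm_pos: "z \<noteq> 0 \<Longrightarrow> eisnorm z > 0"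
  using eisnorm_0_iff[of z] by linarith

lemma eisnorm_mult: "eisnorm (x * y) = eisnorm x * eisnorm y"
proof -
  have "real (eisnorm (x * y)) = real (eisnorm x * eisnorm y)"
    by (simp add: eisnorm_eq norm_mult power_mult_distrib)
  then show ?thesis by (simp only: of_nat_eq_iff)
qed

lemma cmod_toC_ge_1: assumes "z \<noteq> 0" shows "cmod (toC z) \<ge> 1"
proof -
  have "eisnorm z \<ge> 1" using eisnorm_pos[OF assms] by simp
  then have "(cmod (toC z))\<^sup>2 \<ge> 1\<^sup>2" unfolding eisnorm_eq[symmetric] by simp
  then show ?thesis by (rule power2_le_imp_le) simp
qed

text \<open>Rounding both coordinates of the complex quotient leaves an error x + y \<omega> with
  |x|, |y| at most 1/2, of squared modulus at most 3/4. The clause on exact divisibility is there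
  because the division built from it must satisfy \<open>a * b div b = a\<close>.\<close>

lemma eis_division:
  assumes "b \<noteq> 0"
  shows "\<exists>q. eisnorm (a - q * b) < eisnorm b \<and> (b dvd a \<longrightarrow> a = q * b)"
proof (cases "b dvd a")
  case True
  then obtain q where "a = q * b" by (auto simp: dvd_def mult.commute)
  then show ?thesis using assms by (intro exI[of _ q]) (simp add: eisnorm_pos eisnorm_def[of 0])
next
  case False
  define z where "z = toC a / toC b"
  define s where "s = Im z / (sqrt 3 / 2)"
  define r where "r = Re z + s / 2"
  have z: "z = of_real r + of_real s * w3"
    by (simp add: complex_eq_iff r_def s_def w3_def)
  define q :: eis where "q = of_int (round r) + of_int (round s) * \<omega>"
  define x where "x = r - round r"
  define y where "y = s - round s"
  have xy: "\<bar>x\<bar> \<le> 1/2" "\<bar>y\<bar> \<le> 1/2"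
    using of_int_round_abs_le[of r] of_int_round_abs_le[of s]
    by (simp_all add: x_def y_def abs_minus_commute)
  have "z - toC q = of_real x + of_real y * w3"
    by (simp add: z q_def x_def y_def algebra_simps \<omega>.rep_eq)
  then have "(cmod (z - toC q))\<^sup>2 = x\<^sup>2 - x * y + y\<^sup>2" by (simp add: norm_lattice_sq)
  also have "x\<^sup>2 \<le> (1/2)\<^sup>2" "y\<^sup>2 \<le> (1/2)\<^sup>2" "- (x * y) \<le> 1/2 * (1/2)"
    using power_mono[OF xy(1), of 2] power_mono[OF xy(2), of 2] mult_mono[OF xy]
    by (auto simp flip: abs_mult)
  then have "x\<^sup>2 - x * y + y\<^sup>2 \<le> 3/4" by (simp add: power2_eq_square)
  finally have lt: "(cmod (z - toC q))\<^sup>2 < 1" by simp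
  have "toC (a - q * b) = (z - toC q) * toC b"
    using assms by (simp add: z_def field_simps)
  then have "real (eisnorm (a - q * b)) = (cmod (z - toC q))\<^sup>2 * eisnorm b"
    by (simp add: eisnorm_eq norm_mult power_mult_distrib)
  also have "\<dots> < eisnorm b" using lt eisnorm_pos[OF assms] by simp
  finally show ?thesis using False by auto
qed

instantiation eis :: semidom_modulo
begin

definition divide_eis :: "eis \<Rightarrow> eis \<Rightarrow> eis" where
  "a div b = (if b = 0 then 0
     else SOME q. eisnorm (a - q * b) < eisnorm b \<and> (b dvd a \<longrightarrow> a = q * b))"

definition modulo_eis :: "eis \<Rightarrow> eis \<Rightarrow> eis" where
  "modulo_eis a b = a - a div b * b"

lemma eis_div_props:
  assumes "b \<noteq> (0::eis)"
  shows "eisnorm (a - a div b * b) < eisnorm b \<and> (b dvd a \<longrightarrow> a = a div b * b)"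
  using someI_ex[OF eis_division[OF assms, of a]] assms unfolding divide_eis_def by simp

instance
proof
  fix a b :: eis
  show "b \<noteq> 0 \<Longrightarrow> a * b div b = a" using eis_div_props[of b "a * b"] by simp
  show "a div 0 = 0" by (simp add: divide_eis_def)
  show "a div b * b + a mod b = a" by (simp add: modulo_eis_def)
qed

end

text \<open>The predicate under \<open>SOME\<close> is the same for associated elements, hence so is
  the choice; this makes it a valid \<open>normalize\<close>. Units go to 1 so that a unit is its
  own unit factor.\<close>

definition eisrep :: "eis \<Rightarrow> eis" where
  "eisrep x = (if x dvd 1 then 1 else SOME y. y dvd x \<and> x dvd y)"

lemma eisrep_assoc: "eisrep x dvd x \<and> x dvd eisrep x"
proof (cases "x dvd 1")
  case False
  have "\<exists>y. y dvd x \<and> x dvd y" by (intro exI[of _ x]) simp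
  from someI_ex[OF this] show ?thesis using False unfolding eisrep_def by simp
qed (simp add: eisrep_def)

lemma eisrep_unit_mult: "a dvd 1 \<Longrightarrow> eisrep (a * b) = eisrep b"
  unfolding eisrep_def by (simp add: mult_unit_dvd_iff' dvd_mult_unit_iff')

instantiation eis :: normalization_euclidean_semiring
begin

definition euclidean_size_eis :: "eis \<Rightarrow> nat" where "euclidean_size_eis = eisnorm"
definition normalize_eis :: "eis \<Rightarrow> eis" where "normalize_eis = eisrep"
definition unit_factor_eis :: "eis \<Rightarrow> eis" where "unit_factor_eis x = x div eisrep x"

instance
proof
  fix a b :: eis
  have rep0: "eisrep x = 0 \<longleftrightarrow> x = 0" for x using eisrep_assoc[of x] by auto
  show "euclidean_size (0::eis) = 0" by (simp add: euclidean_size_eis_def)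
  show "b \<noteq> 0 \<Longrightarrow> euclidean_size (a mod b) < euclidean_size b"
    using eis_div_props[of b a] by (simp add: euclidean_size_eis_def modulo_eis_def)
  show "b \<noteq> 0 \<Longrightarrow> euclidean_size a \<le> euclidean_size (a * b)"
    using eisnorm_pos[of b] by (simp add: euclidean_size_eis_def eisnorm_mult)
  show "unit_factor (0::eis) = 0" by (simp add: unit_factor_eis_def)
  show "unit_factor a = a" if "a dvd 1"
    using that by (simp add: unit_factor_eis_def eisrep_def)
  show "unit_factor a dvd 1" if "a \<noteq> 0"
  proof -
    obtain c d where cd: "a = eisrep a * c" "eisrep a = a * d"
      using eisrep_assoc[of a] by (meson dvdE)
    then have "a * 1 = a * (d * c)" by (metis mult.assoc mult.right_neutral)
    then have "c dvd 1" using that by (metis dvd_triv_right mult_left_cancel)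
    moreover have "a div eisrep a = c"
      using cd(1) that rep0 by (metis nonzero_mult_div_cancel_left)
    ultimately show ?thesis by (simp add: unit_factor_eis_def)
  qed
  show "unit_factor (a * b) = a * unit_factor b" if "a dvd 1"
    using that eisrep_assoc[of b]
    by (simp add: unit_factor_eis_def eisrep_unit_mult div_mult_swap)
  show "unit_factor a * normalize a = a"
    using eisrep_assoc[of a] by (simp add: unit_factor_eis_def normalize_eis_def)
  show "normalize (0::eis) = 0" by (simp add: normalize_eis_def rep0)
qed

end

instantiation eis :: euclidean_ring_gcd
begin

definition gcd_eis :: "eis \<Rightarrow> eis \<Rightarrow> eis" where "gcd_eis = Euclidean_Algorithm.gcd"
definition lcm_eis :: "eis \<Rightarrow> eis \<Rightarrow> eis" where "lcm_eis = Euclidean_Algorithm.lcm"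
definition Gcd_eis :: "eis set \<Rightarrow> eis" where "Gcd_eis = Euclidean_Algorithm.Gcd"
definition Lcm_eis :: "eis set \<Rightarrow> eis" where "Lcm_eis = Euclidean_Algorithm.Lcm"

instance
  by intro_classes (simp_all add: gcd_eis_def lcm_eis_def Gcd_eis_def Lcm_eis_def)

end

section \<open>Lattice point counts and units\<close>

abbreviation eabs :: "eis \<Rightarrow> real" where "eabs z \<equiv> cmod (toC z)"

lemma eis_ball:
  assumes "H \<ge> 0"
  shows "finite {z. eabs z \<le> H}" and "real (card {z. eabs z \<le> H}) \<le> (4 * H + 1)\<^sup>2"
proof -
  define n where "n = \<lfloor>2 * H\<rfloor>"
  have n: "n \<ge> 0" "of_int n \<le> 2 * H" using assms by (simp_all add: n_def)
  let ?f = "\<lambda>(a, b). of_int a + of_int b * \<omega>"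
  have sub: "{z. eabs z \<le> H} \<subseteq> ?f ` ({-n..n} \<times> {-n..n})"
  proof
    fix z assume "z \<in> {z. eabs z \<le> H}"
    then have zH: "(eabs z)\<^sup>2 \<le> H\<^sup>2" by (auto intro: power_mono)
    obtain a b :: int where z: "z = of_int a + of_int b * \<omega>" by (rule eis_cases)
    have e: "(eabs z)\<^sup>2 = (of_int a)\<^sup>2 - of_int a * of_int b + (of_int b)\<^sup>2"
      using norm_lattice_sq[of "of_int a" "of_int b"] by (simp add: z \<omega>.rep_eq)
    have *: "\<bar>x\<bar> \<le> 2 * H" if "x\<^sup>2 - x * y + y\<^sup>2 \<le> H\<^sup>2" for x y :: real
    proof -
      \<comment> \<open>4 (x^2 - x y + y^2) = 3 x^2 + (x - 2 y)^2, so the norm controls each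
        coordinate.\<close>
      have "0 \<le> (x - 2 * y)\<^sup>2" by simp
      then have "3 * x\<^sup>2 \<le> 4 * (x\<^sup>2 - x * y + y\<^sup>2)"
        by (simp add: power2_eq_square algebra_simps)
      also have "\<dots> \<le> 4 * H\<^sup>2" using that by simp
      finally have "x\<^sup>2 \<le> 4 * H\<^sup>2" using zero_le_power2[of x] by linarith
      then have "x\<^sup>2 \<le> (2 * H)\<^sup>2" by (simp add: power_mult_distrib)
      then show ?thesis using assms abs_le_square_iff[of x "2 * H"] by simp
    qed
    have "\<bar>of_int a :: real\<bar> \<le> 2 * H" "\<bar>of_int b :: real\<bar> \<le> 2 * H"
      using *[of "of_int a" "of_int b"] *[of "of_int b" "of_int a"] e zH
      by (simp_all add: algebra_simps)
    then have "\<bar>a\<bar> \<le> n" "\<bar>b\<bar> \<le> n" unfolding n_def by (simp_all add: le_floor_iff)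
    then show "z \<in> ?f ` ({-n..n} \<times> {-n..n})"
      by (intro image_eqI[of _ _ "(a, b)"]) (auto simp: z)
  qed
  then show fin: "finite {z. eabs z \<le> H}" by (rule finite_subset) simp
  have "card {z. eabs z \<le> H} \<le> card (?f ` ({-n..n} \<times> {-n..n}))"
    by (rule card_mono[OF _ sub]) simp
  also have "\<dots> \<le> card ({-n..n} \<times> {-n..n})" by (rule card_image_le) simp
  also have "\<dots> = nat (2 * n + 1) * nat (2 * n + 1)" by (simp add: card_cartesian_product)
  finally have "real (card {z. eabs z \<le> H}) \<le> real (nat (2 * n + 1) * nat (2 * n + 1))"
    by (simp only: of_nat_le_iff)
  also have "\<dots> = (2 * of_int n + 1)\<^sup>2" using n by (simp add: power2_eq_square)
  also have "\<dots> \<le> (4 * H + 1)\<^sup>2" using n by (intro power_mono) auto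
  finally show "real (card {z. eabs z \<le> H}) \<le> (4 * H + 1)\<^sup>2" .
qed

lemma eabs_unit:
  assumes "u dvd (1::eis)"
  shows "eabs u = 1"
proof -
  obtain v where v: "u * v = 1" using assms by (metis dvdE)
  then have "u \<noteq> 0" "v \<noteq> 0" by auto
  moreover have "eabs u * eabs v = 1" using v by (metis norm_mult norm_one toC_simps(2,6))
  ultimately show ?thesis
    using cmod_toC_ge_1[of u] cmod_toC_ge_1[of v] mult_left_mono[of 1 "eabs v" "eabs u"] by auto
qed

text \<open>25 is the lattice count for the unit disc. The exact number is six, but only an absolute
  constant matters.\<close>

lemma eis_units:
  shows finite_eis_units: "finite {u::eis. u dvd 1}"
    and card_eis_units: "card {u::eis. u dvd 1} \<le> 25"
proof -
  have sub: "{u::eis. u dvd 1} \<subseteq> {z. eabs z \<le> 1}" using eabs_unit by auto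
  show "finite {u::eis. u dvd 1}" by (rule finite_subset[OF sub eis_ball(1)]) simp
  have "card {u::eis. u dvd 1} \<le> card {z. eabs z \<le> 1}"
    by (rule card_mono[OF eis_ball(1) sub]) simp
  also have "real \<dots> \<le> (4 * 1 + 1)\<^sup>2" by (rule eis_ball(2)) simp
  finally show "card {u::eis. u dvd 1} \<le> 25" by simp
qed

lemma eabs_dvd_le:
  assumes "x dvd y" "y \<noteq> 0"
  shows "eabs x \<le> eabs y"
proof -
  obtain k where k: "y = x * k" using assms(1) by (rule dvdE)
  then have "k \<noteq> 0" using assms(2) by auto
  then show ?thesis using k cmod_toC_ge_1[of k] by (simp add: norm_mult mult_le_cancel_left1)
qed

section \<open>Prime factors and classes modulo cubes\<close>

lemma eis_factorization:
  fixes u :: eis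
  assumes "u \<noteq> 0"
  obtains e where "e dvd 1" "u = e * (\<Prod>p\<in>prime_factors u. p ^ multiplicity p u)"
proof -
  have "prod_mset (prime_factorization u) = (\<Prod>p\<in>prime_factors u. p ^ multiplicity p u)"
    unfolding prod_mset_multiplicity
    by (intro prod.cong refl) (auto simp: count_prime_factorization)
  then have "normalize (\<Prod>p\<in>prime_factors u. p ^ multiplicity p u) = normalize u"
    using prod_mset_prime_factorization_weak[OF assms] by simp
  then obtain e where "e dvd 1" "u = e * (\<Prod>p\<in>prime_factors u. p ^ multiplicity p u)"
    using associatedD1 associatedD2
    by (metis associated_iff_dvd dvd_mult_unit_iff' mult.commute associatedE1)
  then show ?thesis by (rule that)
qed

text \<open>The divisor bound argument: a prime p with |p|^\<eta> < 3 lies in a fixed disc, so such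
  primes contribute at most a constant. For each other prime 3 is at most |p|^\<eta>, and the
  product of these distinct primes divides N.\<close>

lemma three_power_prime_factors_le:
  fixes \<eta> :: real
  assumes "\<eta> > 0"
  obtains K where "K \<ge> 1"
    and "\<And>N::eis. N \<noteq> 0 \<Longrightarrow> 3 ^ card (prime_factors N) \<le> K * eabs N powr \<eta>"
proof
  define L :: real where "L = 3 powr (1 / \<eta>)"
  have L: "L powr \<eta> = 3" "L \<ge> 0" using assms by (simp_all add: L_def powr_powr)
  define S where "S = {z. eabs z \<le> L}"
  have finS: "finite S" unfolding S_def using L(2) by (rule eis_ball(1))
  show "(1::real) \<le> 3 ^ card S" by simp
  fix N :: eis assume N: "N \<noteq> 0"
  define P where "P = prime_factors N"
  define T where "T = P - S"
  have finP: "finite P" by (simp add: P_def)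
  have "card P = card (P \<inter> S) + card T"
    unfolding T_def using finP by (metis card_Int_Diff)
  then have "(3::real) ^ card P = 3 ^ card (P \<inter> S) * 3 ^ card T" by (simp add: power_add)
  also have "(3::real) ^ card (P \<inter> S) \<le> 3 ^ card S"
    by (intro power_increasing card_mono finS) auto
  also have "(3::real) ^ card T \<le> eabs N powr \<eta>"
  proof -
    have "(3::real) ^ card T = (\<Prod>p\<in>T. 3)" by simp
    also have "\<dots> \<le> (\<Prod>p\<in>T. eabs p powr \<eta>)"
    proof (rule prod_mono, safe)
      fix p assume "p \<in> T"
      then have "L \<le> eabs p" by (simp add: T_def S_def)
      then have "L powr \<eta> \<le> eabs p powr \<eta>" using L assms by (intro powr_mono2) auto
      then show "3 \<le> eabs p powr \<eta>" by (simp add: L)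
    qed simp
    also have "\<dots> = eabs (\<Prod>p\<in>T. p) powr \<eta>"
      by (simp add: prod_powr_distrib prod_norm[symmetric])
    also have "(\<Prod>p\<in>T. p) dvd N"
    proof -
      obtain e where "e dvd 1" and e: "N = e * (\<Prod>p\<in>P. p ^ multiplicity p N)"
        using eis_factorization[OF N] unfolding P_def by blast
      have "(\<Prod>p\<in>T. p) dvd (\<Prod>p\<in>P. p)"
        by (rule prod_dvd_prod_subset[OF finP]) (auto simp: T_def)
      also have "\<dots> dvd (\<Prod>p\<in>P. p ^ multiplicity p N)"
      proof (rule prod_dvd_prod)
        fix p assume "p \<in> P"
        then have "multiplicity p N > 0" using N
          by (auto simp: P_def prime_factors_multiplicity)
        then show "p dvd p ^ multiplicity p N" by (simp add: dvd_power)
      qed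
      also have "\<dots> dvd N" by (subst (2) e) simp
      finally show ?thesis .
    qed
    then have "eabs (\<Prod>p\<in>T. p) powr \<eta> \<le> eabs N powr \<eta>"
      using assms N by (intro powr_mono2 eabs_dvd_le) auto
    finally show ?thesis .
  qed
  finally show "(3::real) ^ card (prime_factors N) \<le> 3 ^ card S * eabs N powr \<eta>"
    by (simp add: P_def mult_right_mono)
qed

text \<open>Representatives modulo cubes of the elements whose valuation is divisible by 3 at every
  prime outside \<open>N\<close>. They serve as the coefficients of the descent curves; extensional
  exponent functions make them easy to count.\<close>

definition cube_reps :: "eis \<Rightarrow> eis set" where
  "cube_reps N = (\<lambda>(e, f). e * (\<Prod>p\<in>prime_factors N. p ^ f p)) `
     ({e. e dvd 1} \<times> (prime_factors N \<rightarrow>\<^sub>E {0, 1, 2::nat}))"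

lemma finite_cube_reps: "finite (cube_reps N)"
  unfolding cube_reps_def
  by (intro finite_imageI finite_cartesian_product finite_eis_units finite_PiE) auto

lemma card_cube_reps: "card (cube_reps N) \<le> 25 * 3 ^ card (prime_factors N)"
proof -
  have "card (cube_reps N) \<le> card ({e::eis. e dvd 1} \<times> (prime_factors N \<rightarrow>\<^sub>E {0, 1, 2::nat}))"
    unfolding cube_reps_def
    by (intro card_image_le finite_cartesian_product finite_eis_units finite_PiE) auto
  also have "\<dots> = card {e::eis. e dvd 1} * 3 ^ card (prime_factors N)"
    by (simp add: card_cartesian_product card_PiE numeral_3_eq_3)
  finally show ?thesis using card_eis_units by (meson le_trans mult_le_mono1)
qed

text \<open>Each exponent m is split as m mod 3 plus 3 (m div 3). The quotients form the cube, and
  the remainders vanish at primes not dividing \<open>N\<close>.\<close>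

lemma cube_rep_exists:
  assumes "u \<noteq> 0" "N \<noteq> 0"
    and mult: "\<And>p. prime p \<Longrightarrow> \<not> p dvd N \<Longrightarrow> 3 dvd multiplicity p u"
  shows "\<exists>a\<in>cube_reps N. \<exists>x. u = a * x ^ 3"
proof -
  define P where "P = prime_factors u \<union> prime_factors N"
  define m where "m p = multiplicity p u" for p
  have finP: "finite P" by (simp add: P_def)
  obtain e where e: "e dvd 1" and u: "u = e * (\<Prod>p\<in>prime_factors u. p ^ m p)"
    using eis_factorization[OF assms(1)] unfolding m_def by blast
  have "(\<Prod>p\<in>prime_factors u. p ^ m p) = (\<Prod>p\<in>P. p ^ m p)"
    by (rule prod.mono_neutral_left[OF finP]) (auto simp: P_def m_def prime_factors_multiplicity)
  also have "\<dots> = (\<Prod>p\<in>P. p ^ (m p mod 3) * (p ^ (m p div 3)) ^ 3)"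
    by (intro prod.cong refl) (simp flip: power_mult power_add)
  also have "\<dots> = (\<Prod>p\<in>P. p ^ (m p mod 3)) * (\<Prod>p\<in>P. p ^ (m p div 3)) ^ 3"
    by (simp add: prod.distrib prod_power_distrib)
  also have "(\<Prod>p\<in>P. p ^ (m p mod 3)) = (\<Prod>p\<in>prime_factors N. p ^ (m p mod 3))"
  proof (rule prod.mono_neutral_right[OF finP])
    show "\<forall>p\<in>P - prime_factors N. p ^ (m p mod 3) = 1"
    proof
      fix p assume "p \<in> P - prime_factors N"
      then have "prime p" "\<not> p dvd N" using assms(2) by (auto simp: P_def in_prime_factors_iff)
      then show "p ^ (m p mod 3) = 1" using mult by (simp add: m_def)
    qed
  qed (auto simp: P_def)
  also have "\<dots> = (\<Prod>p\<in>prime_factors N. p ^ (restrict (\<lambda>p. m p mod 3) (prime_factors N) p))"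
    by (intro prod.cong) auto
  finally have "u = e * (\<Prod>p\<in>prime_factors N. p ^ (restrict (\<lambda>p. m p mod 3) (prime_factors N) p))
      * (\<Prod>p\<in>P. p ^ (m p div 3)) ^ 3"
    using u by (simp add: mult_ac)
  moreover have "e * (\<Prod>p\<in>prime_factors N. p ^ (restrict (\<lambda>p. m p mod 3) (prime_factors N) p))
      \<in> cube_reps N"
    unfolding cube_reps_def
    by (rule image_eqI[of _ _ "(e, restrict (\<lambda>p. m p mod 3) (prime_factors N))"])
      (use e in \<open>auto intro!: restrict_PiE\<close>)
  ultimately show ?thesis by blast
qed


section \<open>Differences of points on a diagonal cubic\<close>

text \<open>
  This is the difference of two points of the torsor \<open>a x\<^sup>3 + b y\<^sup>3 + c z\<^sup>3 = 0\<close>, a point of its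
  Jacobian \<open>Y\<^sup>3 + Z\<^sup>3 + a b c T\<^sup>3 = 0\<close>. The formula is Desboves' secant formula after exchanging the
  last two coordinates of one point, which over the algebraic closure is negation.
\<close>
lemma residual_point_on_jacobian:
  fixes a b c x y z x' y' z' :: "'r::idom"
  assumes "a \<noteq> 0"
    and P: "a * x^3 + b * y^3 + c * z^3 = 0" and R: "a * x'^3 + b * y'^3 + c * z'^3 = 0"
  shows "(b * y^2 * x' * y' - c * z'^2 * x * z)^3 + (c * z^2 * x' * z' - b * y'^2 * x * y)^3
     + a * b * c * (x^2 * y' * z' - x'^2 * y * z)^3 = 0" (is "?L = 0")
proof -
  have "a * ?L = 0" using P R by algebra
  then show ?thesis using assms(1) by simp
qed

text \<open>
  The common factor \<open>w w' - v v'\<close> has half the degree; dividing it out below is what turns the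
  trivial height bound for a difference of points into one that gains.
\<close>
lemma composition_cubic_coeffs:
  fixes a b c x y z x' y' z' :: "'r::idom"
  assumes P: "a * x^3 + b * y^3 + c * z^3 = 0" and R: "a * x'^3 + b * y'^3 + c * z'^3 = 0"
  defines "A \<equiv> b * y^2 * x' * y'" and "B \<equiv> c * z'^2 * x * z"
    and "C \<equiv> c * z^2 * x' * z'" and "D \<equiv> b * y'^2 * x * y"
    and "v \<equiv> b * y^3" and "w \<equiv> c * z^3" and "v' \<equiv> b * y'^3" and "w' \<equiv> c * z'^3"
  shows "a * (A^3 - B^3) = (w * w' - v * v') * (w * w' + v * v' + v * w')"
    and "a * (A^2 * C - B^2 * D) = (w * w' - v * v') * (b * c * y * z^2 * y'^2 * z')"
    and "a * (A * C^2 - B * D^2) = (w * w' - v * v') * (- (b * c * y^2 * z * y' * z'^2))"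
    and "a * (C^3 - D^3) = (w * w' - v * v') * (- (v * v' + w * w' + w * v'))"
  using P R unfolding A_def B_def C_def D_def v_def w_def v'_def w'_def by algebra+

section \<open>Gauss' lemma for products of linear forms\<close>

text \<open>A prime constant stays prime in the polynomial ring and divides no linear polynomial
  with coprime coefficients, so it must divide the scalar.\<close>

lemma dvd_linear_product:
  fixes p :: "'a::factorial_semiring_gcd"
  assumes "prime p" "[:p:] dvd smult m ([:y0, z0:] * [:y1, z1:] * [:y2, z2:])"
    and "coprime y0 z0" "coprime y1 z1" "coprime y2 z2"
  shows "p dvd m"
proof -
  have pe: "prime_elem [:p:]"
    using assms(1) by (simp add: prime_elem_const_poly_iff)
  have no: "\<not> [:p:] dvd [:y, z:]" if "coprime y z" for y z
  proof
    assume "[:p:] dvd [:y, z:]"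
    then have "p dvd y" "p dvd z"
      unfolding const_poly_dvd_iff by (metis coeff_pCons_0, metis coeff_pCons_0 coeff_pCons_Suc)
    then have "p dvd 1" using that by (meson coprime_common_divisor)
    then show False using assms(1) by auto
  qed
  have "[:m:] * L = smult m L" for L by simp
  then have "[:p:] dvd [:m:] * ([:y0, z0:] * [:y1, z1:] * [:y2, z2:])"
    using assms(2) by metis
  then have "[:p:] dvd [:m:]"
    using no assms(3-5) by (auto simp only: prime_elem_dvd_mult_iff[OF pe])
  then show ?thesis unfolding const_poly_dvd_iff by (metis coeff_pCons_0)
qed

text \<open>After cancelling the gcd of \<open>m\<close> and \<open>n\<close>, a prime dividing the
  remaining part of \<open>n\<close> would divide the remaining part of \<open>m\<close> as well.
  Hence \<open>n\<close> cancels completely and the scalar \<open>k\<close> lies in the ring, not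
  just in its fraction field.\<close>

lemma gauss_linear_product:
  fixes m n :: "'a::{factorial_ring_gcd,ring_gcd}"
  assumes "smult m ([:y0, z0:] * [:y1, z1:] * [:y2, z2:]) = smult n G" "n \<noteq> 0"
    and "coprime y0 z0" "coprime y1 z1" "coprime y2 z2"
  obtains k where "G = smult k ([:y0, z0:] * [:y1, z1:] * [:y2, z2:])"
proof -
  let ?L = "[:y0, z0:] * [:y1, z1:] * [:y2, z2:]"
  define d where "d = gcd m n"
  obtain m1 n1 where mn: "m = m1 * d" "n = n1 * d" "coprime m1 n1"
    unfolding d_def using gcd_coprime_exists[of m n] assms(2) by auto
  have d: "d \<noteq> 0" and n1: "n1 \<noteq> 0" using mn assms(2) by auto
  have "smult d (smult m1 ?L) = smult d (smult n1 G)"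
    using assms(1) by (simp only: mn smult_smult mult.commute)
  then have eq: "smult m1 ?L = smult n1 G" using d by (metis smult_cancel)
  have "n1 dvd 1"
  proof (rule ccontr)
    assume "\<not> n1 dvd 1"
    then obtain p where p: "prime p" "p dvd n1" using prime_divisor_exists n1 by blast
    have "[:p:] dvd smult n1 G" using p(2) by (simp add: const_poly_dvd_iff)
    then have "p dvd m1" using dvd_linear_product[OF p(1)] eq assms(3-5) by metis
    then have "p dvd 1" using p mn(3) coprime_common_divisor by blast
    then show False using p(1) by auto
  qed
  then obtain n2 where n2: "1 = n1 * n2" by (rule dvdE)
  have "smult (n2 * m1) ?L = smult (n2 * n1) G"
    using arg_cong[OF eq, of "smult n2"] by (simp only: smult_smult)
  then have "G = smult (n2 * m1) ?L" using n2 by (simp add: mult.commute)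
  then show ?thesis by (rule that)
qed

section \<open>Heights of the linear factors of a binary cubic\<close>

text \<open>Two small values bound their difference (s - t) z, hence z, hence y. The constant is 7 =
  1 + 3 * 2: one value of the form plus at most 3 |z|, where 7 |z| is below twice the
  maximum.\<close>

lemma linear_form_small_once:
  fixes y z :: complex and s t :: nat
  assumes "s \<le> 3" "t \<le> 3" "7 * cmod (y + of_nat s * z) < max (cmod y) (cmod z)"
    and "7 * cmod (y + of_nat t * z) < max (cmod y) (cmod z)"
  shows "s = t"
proof (rule ccontr)
  assume "s \<noteq> t"
  then have "\<bar>int s - int t\<bar> \<ge> 1" by linarith
  then have "\<bar>of_int (int s - int t) :: real\<bar> \<ge> 1" by linarith
  then have st: "\<bar>real s - real t\<bar> \<ge> 1" by simp
  have "(y + of_nat s * z) - (y + of_nat t * z) = of_real (real s - real t) * z"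
    by (simp add: algebra_simps)
  then have "\<bar>real s - real t\<bar> * cmod z \<le> cmod (y + of_nat s * z) + cmod (y + of_nat t * z)"
    by (metis norm_mult norm_of_real norm_triangle_ineq4)
  moreover have "1 * cmod z \<le> \<bar>real s - real t\<bar> * cmod z"
    using st by (intro mult_right_mono) auto
  ultimately have z: "7 * cmod z < 2 * max (cmod y) (cmod z)" using assms(3,4) by linarith
  have "cmod y \<le> cmod (y + of_nat s * z) + cmod (of_nat s * z)"
    using norm_triangle_ineq4[of "y + of_nat s * z" "of_nat s * z"] by simp
  moreover have "cmod (of_nat s * z) \<le> 3 * cmod z"
    using assms(1) by (simp add: norm_mult mult_right_mono)
  ultimately show False using z assms(3) norm_ge_zero[of z] by linarith
qed

text \<open>Pigeonhole: each of the three forms excludes at most one of the four arguments 0, 1, 2,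
  3.\<close>

lemma linear_forms_common_large_value:
  fixes y z :: "nat \<Rightarrow> complex"
  obtains s :: nat where "s \<le> 3"
    and "\<And>i. i < 3 \<Longrightarrow> max (cmod (y i)) (cmod (z i)) \<le> 7 * cmod (y i + of_nat s * z i)"
proof -
  define bad where
    "bad i = {s. s \<le> 3 \<and> 7 * cmod (y i + of_nat s * z i) < max (cmod (y i)) (cmod (z i))}" for i
  have fin: "finite (bad i)" for i unfolding bad_def by simp
  have c1: "card (bad i) \<le> 1" for i
  proof -
    have "card (bad i) \<le> Suc 0"
      unfolding card_le_Suc0_iff_eq[OF fin] unfolding bad_def using linear_form_small_once by blast
    then show ?thesis by simp
  qed
  have "card (\<Union>i<3. bad i) \<le> (\<Sum>i<3. card (bad i))" by (rule card_UN_le) simp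
  also have "\<dots> \<le> (\<Sum>i<3::nat. 1)" by (rule sum_mono) (rule c1)
  finally have "card (\<Union>i<3. bad i) < card {..3::nat}" by simp
  then obtain s where "s \<in> {..3}" "s \<notin> (\<Union>i<3. bad i)"
    by (metis card_mono finite_UN_I fin finite_lessThan linorder_not_le subsetI)
  then show ?thesis by (intro that[of s]) (auto simp: bad_def not_less)
qed

text \<open>At a common argument s where all three forms are large, the product of their heights is
  at most 7^3 times the cubic's value, which is at most (1 + 3 + 9 + 27) M; here 343 * 40 = 13720. A
  nonzero \<open>k\<close> has modulus at least 1 and can only help.\<close>

lemma linear_factor_of_small_height:
  fixes y z :: "nat \<Rightarrow> eis"
  assumes G: "[:g0, g1, g2, g3:] = smult k ([:y 0, z 0:] * [:y 1, z 1:] * [:y 2, z 2:])"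
    and "k \<noteq> 0"
    and M: "eabs g0 \<le> M" "eabs g1 \<le> M" "eabs g2 \<le> M" "eabs g3 \<le> M"
    and r: "13720 * M \<le> r ^ 3" "r \<ge> 0"
  obtains i where "i < 3" "eabs (y i) \<le> r" "eabs (z i) \<le> r"
proof -
  define h where "h i = max (eabs (y i)) (eabs (z i))" for i
  obtain s :: nat where s: "s \<le> 3"
    and h: "\<And>i. i < 3 \<Longrightarrow> h i \<le> 7 * cmod (toC (y i) + of_nat s * toC (z i))"
    unfolding h_def using linear_forms_common_large_value[of "\<lambda>i. toC (y i)" "\<lambda>i. toC (z i)"] by blast
  define l where "l i = eabs (y i + of_nat s * z i)" for i
  have hl: "h i \<le> 7 * l i" if "i < 3" for i using h[OF that] by (simp add: l_def)
  have h0: "h i \<ge> 0" for i by (simp add: h_def le_max_iff_disj)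
  have "poly [:g0, g1, g2, g3:] (of_nat s)
      = k * ((y 0 + of_nat s * z 0) * (y 1 + of_nat s * z 1) * (y 2 + of_nat s * z 2))"
    unfolding G by (simp add: algebra_simps)
  then have "eabs (poly [:g0, g1, g2, g3:] (of_nat s)) = eabs k * (l 0 * l 1 * l 2)"
    unfolding l_def by (simp only: toC_simps norm_mult)
  moreover have "1 * (l 0 * l 1 * l 2) \<le> eabs k * (l 0 * l 1 * l 2)"
    using cmod_toC_ge_1[OF \<open>k \<noteq> 0\<close>] by (intro mult_right_mono) (auto simp: l_def)
  ultimately have 1: "l 0 * l 1 * l 2 \<le> eabs (poly [:g0, g1, g2, g3:] (of_nat s))" by simp
  have M0: "M \<ge> 0" using M(1) norm_ge_zero order_trans by blast
  have "eabs (poly [:g0, g1, g2, g3:] (of_nat s))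
      = cmod (toC g0 + of_nat s * toC g1 + of_nat s ^ 2 * toC g2 + of_nat s ^ 3 * toC g3)"
    by (simp add: algebra_simps power2_eq_square power3_eq_cube)
  also have "\<dots> \<le> eabs g0 + real s * eabs g1 + real s ^ 2 * eabs g2 + real s ^ 3 * eabs g3"
    by (intro norm_triangle_le add_mono) (simp_all add: norm_mult norm_power)
  also have "\<dots> \<le> M + 3 * M + 3 ^ 2 * M + 3 ^ 3 * M"
    using s M M0 by (intro add_mono mult_mono power_mono) auto
  finally have 2: "l 0 * l 1 * l 2 \<le> 40 * M" using 1 by simp
  have "h 0 * h 1 * h 2 \<le> (7 * l 0) * (7 * l 1) * (7 * l 2)"
    using hl[of 0] hl[of 1] hl[of 2] h0 by (intro mult_mono) (auto simp: l_def)
  also have "\<dots> = 343 * (l 0 * l 1 * l 2)" by simp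
  also have "\<dots> \<le> r ^ 3" using 2 r by linarith
  finally have "h 0 * h 1 * h 2 \<le> r ^ 3" .
  moreover have "h 0 * h 1 * h 2 > r ^ 3" if "\<And>i. i < 3 \<Longrightarrow> h i > r"
    using that[of 0] that[of 1] that[of 2] r(2) unfolding power3_eq_cube
    by (intro mult_strict_mono mult_nonneg_nonneg mult_pos_pos) auto
  ultimately obtain i where "i < 3" "h i \<le> r" by (meson not_le)
  then show ?thesis by (intro that[of i]) (auto simp: h_def)
qed

text \<open>The factor \<open>y i + z i X\<close> vanishes at X = -y i / z i; the homogeneous form
  also covers \<open>z i = 0\<close>. This relation later ties a small difference to the point it
  came from.\<close>

lemma root_of_linear_product:
  fixes y z :: "nat \<Rightarrow> 'a::idom"
  assumes "[:g0, g1, g2, g3:] = smult k ([:y 0, z 0:] * [:y 1, z 1:] * [:y 2, z 2:])" "i < 3"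
  shows "g0 * z i ^ 3 - g1 * y i * z i ^ 2 + g2 * y i ^ 2 * z i - g3 * y i ^ 3 = 0"
proof -
  have g: "g0 = k * (y 0 * y 1 * y 2)" "g1 = k * (y 0 * y 1 * z 2 + y 0 * z 1 * y 2 + z 0 * y 1 * y 2)"
    "g2 = k * (y 0 * z 1 * z 2 + z 0 * y 1 * z 2 + z 0 * z 1 * y 2)" "g3 = k * (z 0 * z 1 * z 2)"
    using assms(1) by (simp_all add: algebra_simps)
  consider "i = 0" | "i = 1" | "i = 2" using assms(2) by linarith
  then show ?thesis by cases (simp_all add: g algebra_simps power2_eq_square power3_eq_cube)
qed

lemma omega_cube: "\<omega> ^ 3 = 1"
proof -
  have "\<omega> ^ 3 = (\<omega> * \<omega>) * \<omega>" by (simp add: power3_eq_cube)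
  then show ?thesis by (simp add: omega_sq algebra_simps)
qed

text \<open>
  Multiplying \<open>x'\<close> by \<open>\<omega>\<^sup>i\<close> gives three differences \<open>(Y\<^sub>i : Z\<^sub>i)\<close>. They are the roots of one binary cubic
  whose coefficients are quadratic in the heights, so the smallest of the three has height
  at most about the two-thirds power. Exact cancellation (Gauss' lemma) keeps the constants absolute.
\<close>
lemma small_point_from_two_points:
  fixes a b c x y z x' y' z' :: eis
  defines "v \<equiv> b * y^3" and "w \<equiv> c * z^3" and "v' \<equiv> b * y'^3" and "w' \<equiv> c * z'^3"
  assumes P: "a * x^3 + b * y^3 + c * z^3 = 0" and R: "a * x'^3 + b * y'^3 + c * z'^3 = 0"
    and nz: "a \<noteq> 0" "b * c * y * z * y' * z' \<noteq> 0" "w * w' \<noteq> v * v'"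
    and K: "eabs v \<le> K" "eabs w \<le> K" "eabs v' \<le> K" "eabs w' \<le> K"
    and r: "41160 * K\<^sup>2 \<le> r ^ 3" "r \<ge> 0"
  obtains p q where "coprime p q" "eabs p \<le> r" "eabs q \<le> r"
    and "\<exists>s t. s \<noteq> 0 \<and> (p^3 + q^3) * s^3 = a * b * c * t^3"
    and "(w * w' + v * v' + v * w') * q^3 - 3 * (b * c * y * z^2 * y'^2 * z') * p * q^2
       - 3 * (b * c * y^2 * z * y' * z'^2) * p^2 * q + (v * v' + w * w' + w * v') * p^3 = 0"
proof -
  define A where "A = b * y^2 * x' * y'"
  define B where "B = c * z'^2 * x * z"
  define C where "C = c * z^2 * x' * z'"
  define D where "D = b * y'^2 * x * y"
  define g0 where "g0 = w * w' + v * v' + v * w'"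
  define g1 where "g1 = 3 * (b * c * y * z^2 * y'^2 * z')"
  define g2 where "g2 = - 3 * (b * c * y^2 * z * y' * z'^2)"
  define g3 where "g3 = - (v * v' + w * w' + w * v')"
  define n where "n = w * w' - v * v'"
  define Y where "Y i = \<omega> ^ i * A - B" for i
  define Z where "Z i = \<omega> ^ i * C - D" for i
  note ids = composition_cubic_coeffs[OF P R, folded v_def w_def v'_def w'_def, folded A_def B_def C_def D_def n_def]
  have n0: "n \<noteq> 0" using nz(3) by (simp add: n_def)
  have g10: "g1 \<noteq> 0" using nz(2) by (auto simp: g1_def)
  \<comment> \<open>The product of \<omega>^i \<alpha> - \<beta> over i < 3 is \<alpha>^3 -
    \<beta>^3, applied to \<alpha> = A + C X and \<beta> = B + D X.\<close>
  have prodYZ: "[:Y 0, Z 0:] * [:Y 1, Z 1:] * [:Y 2, Z 2:]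
      = [:A^3 - B^3, 3 * (A^2 * C - B^2 * D), 3 * (A * C^2 - B * D^2), C^3 - D^3:]"
    unfolding Y_def Z_def by (simp, intro conjI) (use omega_sq in algebra)+
  have eq: "smult a ([:Y 0, Z 0:] * [:Y 1, Z 1:] * [:Y 2, Z 2:]) = smult n [:g0, g1, g2, g3:]"
  proof -
    have "a * (A^3 - B^3) = n * g0" "a * (C^3 - D^3) = n * g3"
      using ids(1,4) by (simp_all add: g0_def g3_def)
    moreover have "a * (3 * (A^2 * C - B^2 * D)) = n * g1" unfolding g1_def using ids(2) by algebra
    moreover have "a * (3 * (A * C^2 - B * D^2)) = n * g2" unfolding g2_def using ids(3) by algebra
    ultimately show ?thesis unfolding prodYZ by (simp only: smult_pCons smult_0_right)
  qed
  have YZ0: "Y i \<noteq> 0 \<or> Z i \<noteq> 0" if "i < 3" for i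
  proof (rule ccontr)
    assume "\<not> (Y i \<noteq> 0 \<or> Z i \<noteq> 0)"
    then have "[:Y i, Z i:] = 0" by simp
    moreover have "i = 0 \<or> i = 1 \<or> i = 2" using that by linarith
    ultimately have "smult n [:g0, g1, g2, g3:] = 0" by (metis eq mult_zero_left mult_zero_right smult_0_right)
    then show False using n0 g10 by simp
  qed
  have "\<exists>g y z. Y i = y * g \<and> Z i = z * g \<and> coprime y z \<and> g \<noteq> 0" if "i < 3" for i
    using gcd_coprime_exists[of "Y i" "Z i"] YZ0[OF that] by (metis gcd_eq_0_iff)
  then obtain g p q where gpq: "\<And>i. i < 3 \<Longrightarrow> Y i = p i * g i" "\<And>i. i < 3 \<Longrightarrow> Z i = q i * g i"
    "\<And>i. i < 3 \<Longrightarrow> coprime (p i) (q i)" "\<And>i. i < (3::nat) \<Longrightarrow> g i \<noteq> 0"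
    by metis
  have "[:Y i, Z i:] = smult (g i) [:p i, q i:]" if "i < 3" for i
    using gpq(1,2)[OF that] by (simp add: mult.commute)
  then have "[:Y 0, Z 0:] * [:Y 1, Z 1:] * [:Y 2, Z 2:]
    = smult (g 0) [:p 0, q 0:] * smult (g 1) [:p 1, q 1:] * smult (g 2) [:p 2, q 2:]" by auto
  also have "\<dots> = smult (g 0 * g 1 * g 2) ([:p 0, q 0:] * [:p 1, q 1:] * [:p 2, q 2:])"
    by (simp only: mult_smult_left mult_smult_right smult_smult mult_ac)
  finally have scaled: "smult (a * (g 0 * g 1 * g 2)) ([:p 0, q 0:] * [:p 1, q 1:] * [:p 2, q 2:])
    = smult n [:g0, g1, g2, g3:]"
    using eq by (simp only: smult_smult)
  obtain k where k: "[:g0, g1, g2, g3:] = smult k ([:p 0, q 0:] * [:p 1, q 1:] * [:p 2, q 2:])"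
    by (rule gauss_linear_product[OF scaled n0 gpq(3)[of 0] gpq(3)[of 1] gpq(3)[of 2]])
      (simp, simp, simp, rule that)
  have k0: "k \<noteq> 0" using k g10 by auto
  have K0: "K \<ge> 0" using K(1) norm_ge_zero order_trans by blast
  have vv: "eabs (s * t) \<le> K\<^sup>2" if "eabs s \<le> K" "eabs t \<le> K" for s t
    using that K0 by (simp add: norm_mult power2_eq_square mult_mono)
  have three: "eabs (s + t + u) \<le> 3 * K\<^sup>2" if "eabs s \<le> K\<^sup>2" "eabs t \<le> K\<^sup>2" "eabs u \<le> K\<^sup>2" for s t u
    using that norm_triangle_ineq[of "toC s + toC t" "toC u"] norm_triangle_ineq[of "toC s" "toC t"]
    by simp
  \<comment> \<open>The cube of each middle coefficient, without its factor 3, is a monomial of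
    degree six in \<open>v\<close>, \<open>w\<close>, \<open>v'\<close>, \<open>w'\<close>; this
    bounds it without any bound on \<open>b\<close>, \<open>c\<close> or the coordinates
    separately.\<close>
  have mid: "eabs s \<le> K\<^sup>2" if "s^3 = t1 * t2^2 * t3^2 * t4"
    "eabs t1 \<le> K" "eabs t2 \<le> K" "eabs t3 \<le> K" "eabs t4 \<le> K" for s t1 t2 t3 t4
  proof -
    have "eabs s ^ 3 = eabs (s^3)" by (simp add: norm_power)
    also have "\<dots> = eabs t1 * eabs t2 ^ 2 * eabs t3 ^ 2 * eabs t4"
      by (simp add: that(1) norm_mult norm_power)
    also have "\<dots> \<le> K * K^2 * K^2 * K"
      using that(2-5) K0 by (intro mult_mono power_mono) auto
    also have "\<dots> = (K\<^sup>2) ^ 3" by (simp add: eval_nat_numeral)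
    finally show ?thesis by (subst (asm) power_mono_iff) auto
  qed
  have G: "eabs g0 \<le> 3 * K\<^sup>2" "eabs g3 \<le> 3 * K\<^sup>2"
    unfolding g0_def g3_def toC_simps(3) norm_minus_cancel
    by (intro three vv K)+
  have G1: "eabs (b * c * y * z^2 * y'^2 * z') \<le> K\<^sup>2"
    by (rule mid[OF _ K(1) K(2) K(3) K(4)]) (simp add: v_def w_def v'_def w'_def power_mult_distrib
       eval_nat_numeral mult_ac)
  have G2: "eabs (b * c * y^2 * z * y' * z'^2) \<le> K\<^sup>2"
    by (rule mid[OF _ K(2) K(1) K(4) K(3)]) (simp add: v_def w_def v'_def w'_def power_mult_distrib
       eval_nat_numeral mult_ac)
  have "eabs g1 \<le> 3 * K\<^sup>2" "eabs g2 \<le> 3 * K\<^sup>2"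
    unfolding g1_def g2_def toC_simps(6)[of 3] toC_simps(6)[of "- 3"] norm_mult using G1 G2 by simp_all
  \<comment> \<open>All four coefficients are at most 3 K^2, and 3 * 13720 = 41160.\<close>
  with G have "\<exists>i<3. eabs (p i) \<le> r \<and> eabs (q i) \<le> r"
    using linear_factor_of_small_height[OF k k0, of "3 * K\<^sup>2" r] r by auto
  then obtain i where i: "i < 3" "eabs (p i) \<le> r" "eabs (q i) \<le> r" by blast
  \<comment> \<open>The twist of the reference point lies on the same curve, so the secant formula
    applies to it and produces exactly \<open>Y i\<close> and \<open>Z i\<close>.\<close>
  have R': "a * (\<omega>^i * x')^3 + b * y'^3 + c * z'^3 = 0"
  proof -
    have "(\<omega>^i)^3 = 1" by (metis omega_cube power_commutes power_mult power_one mult.commute)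
    then show ?thesis using R by (simp add: power_mult_distrib)
  qed
  define T where "T = x^2 * y' * z' - (\<omega>^i * x')^2 * y * z"
  have "Y i ^ 3 + Z i ^ 3 + a * b * c * T ^ 3 = 0"
    using residual_point_on_jacobian[OF nz(1) P R']
    unfolding Y_def Z_def A_def B_def C_def D_def T_def by (simp add: mult_ac)
  then have "(p i ^ 3 + q i ^ 3) * g i ^ 3 = a * b * c * (- T) ^ 3"
    unfolding gpq(1,2)[OF i(1)]
    by (simp add: power_mult_distrib algebra_simps add_eq_0_iff)
  then have "\<exists>s t. s \<noteq> 0 \<and> (p i^3 + q i^3) * s^3 = a * b * c * t^3" using gpq(4)[OF i(1)] by blast
  moreover have "(w * w' + v * v' + v * w') * q i^3 - 3 * (b * c * y * z^2 * y'^2 * z') * p i * q i^2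
       - 3 * (b * c * y^2 * z * y' * z'^2) * p i^2 * q i + (v * v' + w * w' + w * v') * p i^3 = 0"
    using root_of_linear_product[OF k i(1)]
    by (simp add: g0_def g1_def g2_def g3_def algebra_simps)
  ultimately show ?thesis by (intro that[OF gpq(3)[OF i(1)] i(2,3)])
qed

section \<open>Descent\<close>

text \<open>
  A point of \<open>p\<^sup>3 + q\<^sup>3 = N t\<^sup>3\<close> is represented by \<open>(p : q)\<close>, up to units; the third coordinate lies in the
  quotient field, hence the denominator \<open>s\<close>.
\<close>
definition jac_pts :: "eis \<Rightarrow> real \<Rightarrow> (eis \<times> eis) set" where
  "jac_pts N H = {(p, q). coprime p q \<and> eabs p \<le> H \<and> eabs q \<le> H \<and>
     (\<exists>s t. s \<noteq> 0 \<and> (p^3 + q^3) * s^3 = N * t^3)}"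

text \<open>The three are p + q, \<omega> (p + \<omega> q) and \<omega>^2 (p + \<omega>^2 q). The
  scaling makes their sum zero and leaves the product p^3 + q^3 unchanged.\<close>

definition fU :: "eis \<Rightarrow> eis \<Rightarrow> eis" where "fU p q = p + q"
definition fV :: "eis \<Rightarrow> eis \<Rightarrow> eis" where "fV p q = \<omega> * p + \<omega>^2 * q"
definition fW :: "eis \<Rightarrow> eis \<Rightarrow> eis" where "fW p q = \<omega>^2 * p + \<omega> * q"

lemma omega_square: "\<omega>^2 = - 1 - \<omega>"
  using omega_sq by (simp add: power2_eq_square)

lemma fU_fV_fW_sum: "fU p q + fV p q + fW p q = 0"
  unfolding fU_def fV_def fW_def using omega_square by algebra

lemma fU_fV_fW_prod: "fU p q * fV p q * fW p q = p^3 + q^3"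
  unfolding fU_def fV_def fW_def using omega_square by algebra

lemma omega_nontrivial: "\<omega> - \<omega>^2 \<noteq> 0"
proof
  assume "\<omega> - \<omega>^2 = 0"
  then have "(3::eis) = 0" using omega_square by algebra
  then show False by simp
qed

lemma eabs_omega: "eabs \<omega> = 1"
  by (rule eabs_unit, rule dvdI[of _ _ "\<omega>^2"]) (use omega_cube in \<open>simp add: eval_nat_numeral\<close>)

lemma eabs_fV_fW:
  assumes "eabs p \<le> H" "eabs q \<le> H"
  shows "eabs (fV p q) \<le> 2 * H" "eabs (fW p q) \<le> 2 * H"
  using assms norm_triangle_ineq[of "toC \<omega> * toC p" "toC \<omega>^2 * toC q"]
    norm_triangle_ineq[of "toC \<omega>^2 * toC p" "toC \<omega> * toC q"]
  by (simp_all add: fV_def fW_def norm_mult norm_power eabs_omega)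

lemma fV_fW_ratio:
  assumes "fV p q * fW p' q' = fV p' q' * fW p q"
  shows "p * q' = p' * q"
proof -
  have "(\<omega> - \<omega>^2) * (p * q' - p' * q) = 0"
    using assms omega_square unfolding fV_def fW_def by algebra
  then show ?thesis using omega_nontrivial by simp
qed

lemma coprime_proportional:
  fixes p q p' q' :: "'a::factorial_semiring_gcd"
  assumes "coprime p q" "coprime p' q'" "p * q' = p' * q"
  obtains e where "e dvd 1" "p' = e * p" "q' = e * q"
proof -
  have d: "p dvd p'" "p' dvd p" "q dvd q'" "q' dvd q"
    using assms
    by (metis coprime_dvd_mult_left_iff dvd_triv_left,
        metis coprime_dvd_mult_left_iff dvd_triv_left,
        metis coprime_commute coprime_dvd_mult_right_iff dvd_triv_right,
        metis coprime_commute coprime_dvd_mult_right_iff dvd_triv_right)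
  obtain e where e: "e dvd 1" "p' = e * p"
    using d(1,2) by (metis associatedI associatedE2)
  show ?thesis
  proof (cases "p = 0")
    case True
    obtain e where "e dvd 1" "q' = e * q"
      using d(3,4) by (metis associatedI associatedE2)
    then show ?thesis using that[of e] True d by auto
  next
    case False
    then have "q' = e * q" using assms(3) e(2) by (metis mult.assoc mult.commute mult_cancel_left)
    then show ?thesis using that e by blast
  qed
qed

text \<open>Coprime pairs representing one projective point differ by a unit, and there are at most
  25 units.\<close>

lemma card_proportional:
  fixes S :: "(eis \<times> eis) set"
  assumes "\<And>p q. (p, q) \<in> S \<Longrightarrow> coprime p q"
    and "\<And>p q p' q'. (p, q) \<in> S \<Longrightarrow> (p', q') \<in> S \<Longrightarrow> p * q' = p' * q"
  shows "finite S \<and> card S \<le> 25"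
proof (cases "S = {}")
  case False
  then obtain p q where pq: "(p, q) \<in> S" by auto
  have "S \<subseteq> (\<lambda>e. (e * p, e * q)) ` {e. e dvd 1}"
  proof
    fix P assume P: "P \<in> S"
    obtain p' q' where P': "P = (p', q')" by (cases P)
    with P pq obtain e where "e dvd 1" "p' = e * p" "q' = e * q"
      using coprime_proportional assms by metis
    then show "P \<in> (\<lambda>e. (e * p, e * q)) ` {e. e dvd 1}" using P' by auto
  qed
  from card_mono[OF _ this] finite_subset[OF this]
  have "finite S" "card S \<le> card ((\<lambda>e. (e * p, e * q)) ` {e. e dvd 1})"
    using finite_eis_units by auto
  moreover have "card ((\<lambda>e. (e * p, e * q)) ` {e. e dvd 1}) \<le> 25"
    using card_image_le[OF finite_eis_units] card_eis_units order_trans by blast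
  ultimately show ?thesis by linarith
qed simp

lemma card_le_25_ratios:
  fixes S :: "(eis \<times> eis) set" and f :: "eis \<times> eis \<Rightarrow> complex"
  assumes cop: "\<And>p q. (p, q) \<in> S \<Longrightarrow> coprime p q"
    and ratio: "\<And>p q p' q'. (p, q) \<in> S \<Longrightarrow> (p', q') \<in> S \<Longrightarrow> f (p, q) = f (p', q') \<Longrightarrow> p * q' = p' * q"
    and F: "finite F" "f ` S \<subseteq> F"
  shows "card S \<le> 25 * card F"
proof -
  let ?T = "\<lambda>c. {P \<in> S. f P = c}"
  have T: "finite (?T c) \<and> card (?T c) \<le> 25" for c
    by (rule card_proportional) (auto intro: cop ratio)
  have "S = (\<Union>c\<in>F. ?T c)" using F(2) by auto
  then have "card S \<le> (\<Sum>c\<in>F. card (?T c))" using card_UN_le[OF F(1), of ?T] by simp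
  also have "\<dots> \<le> (\<Sum>c\<in>F. 25)" by (rule sum_mono) (use T in auto)
  finally show ?thesis by simp
qed

text \<open>One descent class: the points coming from the curve a x^3 + b y^3 + c z^3 = 0. The
  condition \<open>p^3 + q^3 \<noteq> 0\<close> keeps all coefficients and coordinates
  nonzero.\<close>

definition class_pts :: "eis \<Rightarrow> real \<Rightarrow> eis \<Rightarrow> eis \<Rightarrow> eis \<Rightarrow> (eis \<times> eis) set" where
  "class_pts N H a b c = {(p, q) \<in> jac_pts N H. p^3 + q^3 \<noteq> 0 \<and>
     (\<exists>x y z. fU p q = a * x^3 \<and> fV p q = b * y^3 \<and> fW p q = c * z^3)}"

lemma
  assumes H: "H \<ge> 0"
  shows finite_jac_pts: "finite (jac_pts N H)"
    and card_jac_pts: "real (card (jac_pts N H)) \<le> (4 * H + 1) ^ 4"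
proof -
  have sub: "jac_pts N H \<subseteq> {z. eabs z \<le> H} \<times> {z. eabs z \<le> H}" by (auto simp: jac_pts_def)
  have fin: "finite ({z. eabs z \<le> H} \<times> {z. eabs z \<le> H})" using eis_ball(1)[OF H] by simp
  show "finite (jac_pts N H)" by (rule finite_subset[OF sub fin])
  have "real (card (jac_pts N H)) \<le> real (card ({z. eabs z \<le> H} \<times> {z. eabs z \<le> H}))"
    using card_mono[OF fin sub] by simp
  also have "\<dots> = real (card {z. eabs z \<le> H}) * real (card {z. eabs z \<le> H})"
    by (simp add: card_cartesian_product)
  also have "\<dots> \<le> (4 * H + 1)\<^sup>2 * (4 * H + 1)\<^sup>2" using eis_ball(2)[OF H] by (intro mult_mono) auto
  finally show "real (card (jac_pts N H)) \<le> (4 * H + 1) ^ 4" by (simp add: eval_nat_numeral mult_ac)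
qed

lemma jac_pts_mono: "H \<le> H' \<Longrightarrow> jac_pts N H \<subseteq> jac_pts N H'"
  by (auto simp: jac_pts_def)

text \<open>Every point outside the exceptional set \<open>D\<close> is sent to a small difference
  with the fixed point \<open>R\<close>. A given difference leaves at most three ratios
  \<open>y P / z P\<close>, hence 3 * 25 points, and \<open>D\<close> adds at most 25. The constant
  is 164640 = 4 * 41160, since the factors are bounded by K = 2 H.\<close>

lemma card_class_pts:
  assumes H: "H \<ge> 0" and r: "r \<ge> 0" "164640 * H\<^sup>2 \<le> r ^ 3"
  shows "card (class_pts N H a b c) \<le> 25 + 75 * card (jac_pts N r)"
proof (cases "class_pts N H a b c = {}")
  case False
  define K where "K = class_pts N H a b c"
  have "\<exists>x y z. fU (fst P) (snd P) = a * x^3 \<and> fV (fst P) (snd P) = b * y^3 \<and> fW (fst P) (snd P) = c * z^3"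
    if "P \<in> K" for P
    using that unfolding K_def class_pts_def by force
  then obtain x y z where xyz: "\<And>P. P \<in> K \<Longrightarrow> fU (fst P) (snd P) = a * x P^3"
    "\<And>P. P \<in> K \<Longrightarrow> fV (fst P) (snd P) = b * y P^3" "\<And>P. P \<in> K \<Longrightarrow> fW (fst P) (snd P) = c * z P^3"
    by metis
  have cop: "coprime p q" if "(p, q) \<in> K" for p q
    using that by (auto simp: K_def class_pts_def jac_pts_def)
  have nz: "a \<noteq> 0" "b \<noteq> 0" "c \<noteq> 0" "x P \<noteq> 0" "y P \<noteq> 0" "z P \<noteq> 0" if "P \<in> K" for P
  proof -
    have "fst P ^ 3 + snd P ^ 3 \<noteq> 0" using that by (auto simp: K_def class_pts_def)
    then have "(a * x P^3) * (b * y P^3) * (c * z P^3) \<noteq> 0"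
      using fU_fV_fW_prod[of "fst P" "snd P"] xyz[OF that] by simp
    then show "a \<noteq> 0" "b \<noteq> 0" "c \<noteq> 0" "x P \<noteq> 0" "y P \<noteq> 0" "z P \<noteq> 0" by auto
  qed
  have curve: "a * x P^3 + b * y P^3 + c * z P^3 = 0" if "P \<in> K" for P
    using fU_fV_fW_sum[of "fst P" "snd P"] xyz[OF that] by simp
  have bound: "eabs (b * y P^3) \<le> 2 * H" "eabs (c * z P^3) \<le> 2 * H" if "P \<in> K" for P
    using eabs_fV_fW[of "fst P" H "snd P"] that xyz(2,3)[OF that]
    by (auto simp: K_def class_pts_def jac_pts_def)
  obtain R where R: "R \<in> K" using False K_def by auto
  define v where "v P = b * y P^3" for P
  define w where "w P = c * z P^3" for P
  have vw0: "v P \<noteq> 0" "w P \<noteq> 0" if "P \<in> K" for P using nz[OF that] by (simp_all add: v_def w_def)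
  \<comment> \<open>Here the common factor of the composition cubic vanishes and no difference can
    be extracted; but then \<open>R\<close> already fixes the ratio of \<open>v P\<close> to
    \<open>w P\<close>.\<close>
  define D where "D = {P \<in> K. w P * w R = v P * v R}"
  have ratio: "p * q' = p' * q" if "(p, q) \<in> K" "(p', q') \<in> K" "v (p, q) * w (p', q') = v (p', q') * w (p, q)"
    for p q p' q'
    by (rule fV_fW_ratio) (use that(3) xyz[OF that(1)] xyz[OF that(2)] in \<open>simp add: v_def w_def\<close>)
  have D: "finite D \<and> card D \<le> 25"
  proof (rule card_proportional)
    fix p q p' q' assume D: "(p, q) \<in> D" "(p', q') \<in> D"
    then have "w (p, q) * w R = v (p, q) * v R" "w (p', q') * w R = v (p', q') * v R"
      by (auto simp: D_def)
    then have "w R * (v (p, q) * w (p', q')) = w R * (v (p', q') * w (p, q))" by algebra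
    then have "v (p, q) * w (p', q') = v (p', q') * w (p, q)" using vw0(2)[OF R] by simp
    then show "p * q' = p' * q" using ratio D by (auto simp: D_def)
  qed (auto simp: D_def intro: cop)
  define Rel where "Rel S P \<longleftrightarrow> (case S of (p, q) \<Rightarrow>
      (w P * w R + v P * v R + v P * w R) * q^3 - 3 * (b * c * y P * z P^2 * y R^2 * z R) * p * q^2
       - 3 * (b * c * y P^2 * z P * y R * z R^2) * p^2 * q
       + (v P * v R + w P * w R + w P * v R) * p^3 = 0)" for S P
  have ex: "\<exists>S\<in>jac_pts N r. Rel S P" if P: "P \<in> K - D" for P
  proof -
    have PK: "P \<in> K" using P by simp
    have n1: "w P * w R \<noteq> v P * v R" using P by (auto simp: D_def)
    have n2: "b * c * y P * z P * y R * z R \<noteq> 0" using nz[OF PK] nz[OF R] by simp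
    have r3: "41160 * (2 * H)\<^sup>2 \<le> r ^ 3" using r(2) by (simp add: power_mult_distrib)
    obtain p q where pq: "coprime p q" "eabs p \<le> r" "eabs q \<le> r"
      "\<exists>s t. s \<noteq> 0 \<and> (p^3 + q^3) * s^3 = a * b * c * t^3" and rel: "Rel (p, q) P"
      by (rule small_point_from_two_points[OF curve[OF PK] curve[OF R] nz(1)[OF R] n2
          n1[unfolded v_def w_def] bound[OF PK] bound[OF R] r3 r(1)])
        (simp add: Rel_def v_def w_def)
    obtain s t where st: "s \<noteq> 0" "(p^3 + q^3) * s^3 = a * b * c * t^3" using pq(4) by blast
    \<comment> \<open>The point \<open>R\<close> shows that \<open>a * b * c\<close> and
      \<open>N\<close> agree up to a cube in the quotient field, so the small point lies on the
      original curve again and the descent can be repeated.\<close>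
    obtain s0 t0 where st0: "s0 \<noteq> 0" "(fst R^3 + snd R^3) * s0^3 = N * t0^3"
      using R by (auto simp: K_def class_pts_def jac_pts_def)
    have e: "fst R^3 + snd R^3 = a * b * c * (x R * y R * z R)^3"
      using fU_fV_fW_prod[of "fst R" "snd R"] xyz[OF R] by (simp add: power_mult_distrib mult_ac)
    have "(p^3 + q^3) * (s * (x R * y R * z R) * s0)^3 = N * (t * t0)^3"
    proof -
      have "(p^3 + q^3) * (s * (x R * y R * z R) * s0)^3
          = ((p^3 + q^3) * s^3) * ((x R * y R * z R)^3 * s0^3)"
        by (simp only: power_mult_distrib mult_ac)
      also have "\<dots> = t^3 * (a * b * c * (x R * y R * z R)^3 * s0^3)"
        unfolding st(2) by (simp only: mult_ac)
      also have "\<dots> = N * (t * t0)^3"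
        unfolding e[symmetric] st0(2) by (simp only: power_mult_distrib mult_ac)
      finally show ?thesis .
    qed
    moreover have "s * (x R * y R * z R) * s0 \<noteq> 0" using st(1) st0(1) nz[OF R] by simp
    ultimately have "(p, q) \<in> jac_pts N r" using pq(1-3) unfolding jac_pts_def by blast
    then show ?thesis using rel by blast
  qed
  have fib: "card {P \<in> K. Rel S P} \<le> 75" if "S \<in> jac_pts N r" for S
  proof -
    obtain p q where S: "S = (p, q)" by (cases S)
    have pq: "coprime p q" using that by (simp add: S jac_pts_def)
    \<comment> \<open>\<open>Rel S P\<close> divided by \<open>(z P)\<^sup>3\<close> is a cubic equation for \<open>y P / z P\<close>, which determines \<open>P\<close> up to units.\<close>
    define e0 where "e0 = c * w R * q^3 + c * (w R + v R) * p^3"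
    define e1 where "e1 = - 3 * (b * c * y R^2 * z R) * p * q^2"
    define e2 where "e2 = - 3 * (b * c * y R * z R^2) * p^2 * q"
    define e3 where "e3 = b * (v R + w R) * q^3 + b * v R * p^3"
    define Q where "Q = [:toC e0, toC e1, toC e2, toC e3:]"
    \<comment> \<open>This sum is minus \<open>a * x R ^ 3\<close>. If \<open>p\<close> and
      \<open>q\<close> are both nonzero then \<open>e1\<close> is nonzero; otherwise
      \<open>e0\<close> is a nonzero multiple of the cube of the one that survives. So
      \<open>Q\<close> is not the zero polynomial.\<close>
    have "w R + v R \<noteq> 0" using curve[OF R] nz[OF R] by (auto simp: v_def w_def add_eq_0_iff add_ac)
    then have "e0 \<noteq> 0 \<or> e1 \<noteq> 0"
    proof (cases "p = 0 \<or> q = 0")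
      case True
      then have "p \<noteq> 0 \<or> q \<noteq> 0" using pq by auto
      then show ?thesis using True nz[OF R] vw0[OF R] \<open>w R + v R \<noteq> 0\<close> by (auto simp: e0_def)
    qed (use nz[OF R] in \<open>simp add: e1_def\<close>)
    then have Q0: "Q \<noteq> 0" by (auto simp: Q_def)
    have "degree Q \<le> 3" by (simp add: Q_def)
    then have rt: "finite {t. poly Q t = 0}" "card {t. poly Q t = 0} \<le> 3"
      using poly_roots_finite[OF Q0] card_poly_roots_bound[OF Q0] by auto
    have "card {P \<in> K. Rel S P} \<le> 25 * card {t. poly Q t = 0}"
    proof (rule card_le_25_ratios[of _ "\<lambda>P. toC (y P) / toC (z P)"])
      fix p1 q1 p2 q2
      assume K: "(p1, q1) \<in> {P \<in> K. Rel S P}" "(p2, q2) \<in> {P \<in> K. Rel S P}"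
        and eq: "toC (y (p1, q1)) / toC (z (p1, q1)) = toC (y (p2, q2)) / toC (z (p2, q2))"
      have "z (p1, q1) \<noteq> 0" "z (p2, q2) \<noteq> 0" using nz K by auto
      then have "toC (y (p1, q1) * z (p2, q2)) = toC (y (p2, q2) * z (p1, q1))"
        using eq by (simp add: field_simps)
      then have "(y (p1, q1) * z (p2, q2))^3 = (y (p2, q2) * z (p1, q1))^3" by (simp only: toC_eq_iff)
      then have "v (p1, q1) * w (p2, q2) = v (p2, q2) * w (p1, q1)"
        by (simp add: v_def w_def power_mult_distrib mult_ac)
      then show "p1 * q2 = p2 * q1" using ratio K by simp
    next
      show "(\<lambda>P. toC (y P) / toC (z P)) ` {P \<in> K. Rel S P} \<subseteq> {t. poly Q t = 0}"
      proof safe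
        fix P assume P: "P \<in> K" "Rel S P"
        have zP: "toC (z P) \<noteq> 0" using nz[OF P(1)] by simp
        have "e0 * z P^3 + e1 * y P * z P^2 + e2 * y P^2 * z P + e3 * y P^3 = 0"
          using P(2) unfolding Rel_def S prod.case e0_def e1_def e2_def e3_def
          by (simp add: v_def[of P] w_def[of P] algebra_simps)
        then have "toC (e0 * z P^3 + e1 * y P * z P^2 + e2 * y P^2 * z P + e3 * y P^3) = toC 0"
          by (simp only:)
        moreover have "toC (e0 * z P^3 + e1 * y P * z P^2 + e2 * y P^2 * z P + e3 * y P^3)
            = toC (z P)^3 * poly Q (toC (y P) / toC (z P))"
          using zP by (simp add: Q_def field_simps power2_eq_square power3_eq_cube)
        ultimately show "poly Q (toC (y P) / toC (z P)) = 0" using zP by simp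
      qed
    qed (use rt cop in auto)
    then show ?thesis using rt(2) by simp
  qed
  have finJ: "finite (jac_pts N r)" by (rule finite_jac_pts[OF r(1)])
  have finK: "finite K"
    by (rule finite_subset[OF _ finite_jac_pts[OF H, of N]]) (auto simp: K_def class_pts_def)
  have "K \<subseteq> D \<union> (\<Union>S\<in>jac_pts N r. {P \<in> K. Rel S P})" using ex by blast
  then have "card K \<le> card (D \<union> (\<Union>S\<in>jac_pts N r. {P \<in> K. Rel S P}))"
    using D finJ finK by (intro card_mono) auto
  also have "\<dots> \<le> card D + (\<Sum>S\<in>jac_pts N r. card {P \<in> K. Rel S P})"
    by (rule order_trans[OF card_Un_le]) (intro add_left_mono card_UN_le finJ)
  also have "\<dots> \<le> 25 + (\<Sum>S\<in>jac_pts N r. 75)"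
    using D fib by (intro add_mono sum_mono) auto
  finally show ?thesis by (simp add: K_def)
qed simp

section \<open>Splitting into descent classes\<close>

text \<open>When p divides u it divides none of v, w, N, so comparing valuations leaves m(u) + 3
  m(s) = 3 m(t).\<close>

lemma three_dvd_multiplicity:
  fixes u v w s t N :: "'a::factorial_semiring"
  assumes "prime p" "\<not> p dvd N" "u * v * w * s^3 = N * t^3"
    and nz: "u \<noteq> 0" "v \<noteq> 0" "w \<noteq> 0" "s \<noteq> 0"
    and "p dvd u \<Longrightarrow> \<not> p dvd v \<and> \<not> p dvd w"
  shows "3 dvd multiplicity p u"
proof (cases "p dvd u")
  case True
  have pe: "prime_elem p" using assms(1) by simp
  have N: "N \<noteq> 0" using assms(2) by auto
  have "N * t^3 \<noteq> 0" using nz unfolding assms(3)[symmetric] by simp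
  then have t: "t \<noteq> 0" by auto
  have "multiplicity p v = 0" "multiplicity p w = 0" "multiplicity p N = 0"
    using assms(2) assms(8)[OF True] by (simp_all add: not_dvd_imp_multiplicity_0)
  moreover have "multiplicity p (u * v * w * s^3) = multiplicity p (N * t^3)" using assms(3) by simp
  ultimately have "multiplicity p u + 3 * multiplicity p s = 3 * multiplicity p t"
    using nz N t by (simp add: prime_elem_multiplicity_mult_distrib[OF pe]
        prime_elem_multiplicity_power_distrib[OF pe])
  then show ?thesis by presburger
qed (simp add: not_dvd_imp_multiplicity_0)

text \<open>Both 3 p and 3 q are combinations of the two factors, so a common prime away from 3
  would divide the coprime pair.\<close>

lemma fU_fV_no_common_prime:
  assumes "prime d" "\<not> d dvd 3" "coprime p q" "d dvd fU p q" "d dvd fV p q"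
  shows False
proof -
  have "3 * p = (fV p q - \<omega>^2 * fU p q) * (\<omega>^2 - \<omega>)"
    "3 * q = (fV p q - \<omega> * fU p q) * (\<omega> - \<omega>^2)"
    unfolding fU_def fV_def using omega_square by algebra+
  then have "d dvd 3 * p" "d dvd 3 * q" using assms(4,5) by (metis dvd_diff dvd_mult dvd_mult2)+
  then have "d dvd p" "d dvd q" using assms(1,2) by (auto simp: prime_dvd_mult_iff)
  then have "d dvd 1" using assms(3) by (meson coprime_common_divisor)
  then show False using assms(1) by auto
qed

text \<open>The factors sum to zero, so a prime dividing two of them divides all three; outside
  \<open>3 * N\<close> this is impossible. There each factor has valuation divisible by 3 and is a
  cube up to an element of \<open>cube_reps (3 * N)\<close>.\<close>

lemma jac_pts_cover:
  assumes "N \<noteq> 0"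
  shows "jac_pts N H \<subseteq> {(p, q). coprime p q \<and> p^3 + q^3 = 0} \<union>
    (\<Union>(a, b, c)\<in>cube_reps (3 * N) \<times> cube_reps (3 * N) \<times> cube_reps (3 * N). class_pts N H a b c)"
proof safe
  fix p q
  assume J: "(p, q) \<in> jac_pts N H"
    and "(p, q) \<notin> (\<Union>(a, b, c)\<in>cube_reps (3 * N) \<times> cube_reps (3 * N) \<times> cube_reps (3 * N). class_pts N H a b c)"
  then have no: "\<And>a b c. a \<in> cube_reps (3 * N) \<Longrightarrow> b \<in> cube_reps (3 * N) \<Longrightarrow> c \<in> cube_reps (3 * N) \<Longrightarrow>
     (p, q) \<notin> class_pts N H a b c" by auto
  show cop: "coprime p q" using J by (simp add: jac_pts_def)
  obtain s t where st: "s \<noteq> 0" "(p^3 + q^3) * s^3 = N * t^3" using J by (auto simp: jac_pts_def)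
  let ?U = "fU p q" and ?V = "fV p q" and ?W = "fW p q"
  show "p^3 + q^3 = 0"
  proof (rule ccontr)
    assume n0: "p^3 + q^3 \<noteq> 0"
    then have "?U * ?V * ?W \<noteq> 0" by (simp add: fU_fV_fW_prod)
    then have nz: "?U \<noteq> 0" "?V \<noteq> 0" "?W \<noteq> 0" by auto
    have eq: "?U * ?V * ?W * s^3 = N * t^3" using st(2) by (simp add: fU_fV_fW_prod)
    have sum: "?W = - (?U + ?V)" "?U = - (?V + ?W)" "?V = - (?U + ?W)"
      using fU_fV_fW_sum[of p q] by algebra+
    have two: "\<not> (d dvd ?U \<and> d dvd ?V) \<and> \<not> (d dvd ?U \<and> d dvd ?W) \<and> \<not> (d dvd ?V \<and> d dvd ?W)"
      if "prime d" "\<not> d dvd 3 * N" for d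
    proof -
      have "\<not> d dvd 3" using that(2) by auto
      then have UV: "\<not> (d dvd ?U \<and> d dvd ?V)" using fU_fV_no_common_prime that(1) cop by blast
      moreover have "d dvd ?V" if "d dvd ?U" "d dvd ?W" using that sum(3) by (metis dvd_add dvd_minus_iff)
      moreover have "d dvd ?U" if "d dvd ?V" "d dvd ?W" using that sum(2) by (metis dvd_add dvd_minus_iff)
      ultimately show ?thesis by blast
    qed
    have N3: "3 * N \<noteq> 0" using assms by simp
    have "3 dvd multiplicity d ?U \<and> 3 dvd multiplicity d ?V \<and> 3 dvd multiplicity d ?W"
      if d: "prime d" "\<not> d dvd 3 * N" for d
    proof -
      have dN: "\<not> d dvd N" using d(2) by auto
      have eV: "?V * ?U * ?W * s^3 = N * t^3" and eW: "?W * ?U * ?V * s^3 = N * t^3"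
        using eq by (simp_all add: mult_ac)
      have "3 dvd multiplicity d ?U"
        by (rule three_dvd_multiplicity[OF d(1) dN eq nz st(1)]) (use two[OF d] in auto)
      moreover have "3 dvd multiplicity d ?V"
        by (rule three_dvd_multiplicity[OF d(1) dN eV nz(2,1,3) st(1)]) (use two[OF d] in auto)
      moreover have "3 dvd multiplicity d ?W"
        by (rule three_dvd_multiplicity[OF d(1) dN eW nz(3,1,2) st(1)]) (use two[OF d] in auto)
      ultimately show ?thesis by blast
    qed
    then have "\<exists>a\<in>cube_reps (3 * N). \<exists>x. ?U = a * x^3" "\<exists>b\<in>cube_reps (3 * N). \<exists>y. ?V = b * y^3"
      "\<exists>c\<in>cube_reps (3 * N). \<exists>z. ?W = c * z^3"
      using cube_rep_exists[OF nz(1) N3] cube_rep_exists[OF nz(2) N3] cube_rep_exists[OF nz(3) N3] by simp_all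
    then obtain a b c x y z where
      "a \<in> cube_reps (3 * N)" "?U = a * x^3" "b \<in> cube_reps (3 * N)" "?V = b * y^3"
      "c \<in> cube_reps (3 * N)" "?W = c * z^3" by blast
    then show False using no[of a b c] J n0 unfolding class_pts_def by auto
  qed
qed

text \<open>Each of the lines p = -q, p = -\<omega> q and p = -\<omega>^2 q carries a single
  projective point with at most 25 coprime representatives.\<close>

lemma card_torsion_pts:
  "finite {(p, q). coprime p (q::eis) \<and> p^3 + q^3 = 0} \<and>
   card {(p, q). coprime p (q::eis) \<and> p^3 + q^3 = 0} \<le> 75"
proof -
  define T where "T r = {(p, q). coprime p q \<and> p = r * q}" for r :: eis
  have T: "finite (T r) \<and> card (T r) \<le> 25" for r
    by (rule card_proportional) (auto simp: T_def)
  have sub: "{(p, q). coprime p q \<and> p^3 + q^3 = 0} \<subseteq> T (-1) \<union> T (- \<omega>) \<union> T (- (\<omega>^2))"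
  proof clarify
    fix p q :: eis
    assume "coprime p q" "p^3 + q^3 = 0" "(p, q) \<notin> T (- (\<omega>^2))" "(p, q) \<notin> T (- \<omega>)"
    moreover have "(p + q) * (p + \<omega> * q) * (p + \<omega>^2 * q) = p^3 + q^3"
      using omega_square by algebra
    ultimately show "(p, q) \<in> T (-1)" by (auto simp: T_def eq_neg_iff_add_eq_0)
  qed
  have fin: "finite (T (-1) \<union> T (- \<omega>) \<union> T (- (\<omega>^2)))" using T by simp
  have "card (T (-1) \<union> T (- \<omega>) \<union> T (- (\<omega>^2))) \<le> card (T (-1)) + card (T (- \<omega>)) + card (T (- (\<omega>^2)))"
    by (rule order_trans[OF card_Un_le add_right_mono[OF card_Un_le]])
  also have "\<dots> \<le> 25 + 25 + 25" using T by (intro add_mono) auto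
  finally have "card (T (-1) \<union> T (- \<omega>) \<union> T (- (\<omega>^2))) \<le> 75" by simp
  then show ?thesis using card_mono[OF fin sub] finite_subset[OF sub fin] by linarith
qed

section \<open>Iterating the descent\<close>

text \<open>There are at most \<open>Q ^ 3\<close> classes. The added 1 on both sides turns the
  estimate into a pure product that iterates directly; 101 = 1 + 75 + 25 collects the added 1, the
  points with zero sum of cubes and the constant per class.\<close>

lemma card_jac_pts_step:
  assumes N: "N \<noteq> 0" and H: "H \<ge> 0" and r: "r \<ge> 0" "164640 * H\<^sup>2 \<le> r ^ 3"
  defines "Q \<equiv> 25 * 3 ^ card (prime_factors (3 * N))"
  shows "1 + card (jac_pts N H) \<le> 101 * Q ^ 3 * (1 + card (jac_pts N r))"
proof -
  let ?A = "cube_reps (3 * N)"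
  let ?A3 = "?A \<times> ?A \<times> ?A"
  let ?M = "card (jac_pts N r)"
  have finA: "finite ?A3" by (simp add: finite_cube_reps)
  have A3: "card ?A3 \<le> Q ^ 3"
  proof -
    have "card ?A \<le> Q" unfolding Q_def by (rule card_cube_reps)
    then have "card ?A * (card ?A * card ?A) \<le> Q * (Q * Q)" by (intro mult_le_mono)
    then show ?thesis by (simp only: card_cartesian_product power3_eq_cube mult.assoc)
  qed
  have "finite (class_pts N H a b c)" for a b c
    by (rule finite_subset[OF _ finite_jac_pts[OF H, of N]]) (auto simp: class_pts_def)
  then have fin: "finite (\<Union>(a, b, c)\<in>?A3. class_pts N H a b c)" using finA by auto
  have "card (jac_pts N H) \<le> card ({(p, q). coprime p q \<and> p^3 + q^3 = 0} \<union> (\<Union>(a, b, c)\<in>?A3. class_pts N H a b c))"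
    by (rule card_mono[OF _ jac_pts_cover[OF N]]) (use fin card_torsion_pts in blast)
  also have "\<dots> \<le> 75 + (\<Sum>(a, b, c)\<in>?A3. card (class_pts N H a b c))"
    by (rule order_trans[OF card_Un_le], intro add_mono)
      (use card_torsion_pts card_UN_le[OF finA, of "\<lambda>(a, b, c). class_pts N H a b c"]
        in \<open>simp_all add: case_prod_unfold\<close>)
  also have "\<dots> \<le> 75 + (\<Sum>(a, b, c)\<in>?A3. 25 + 75 * ?M)"
    using card_class_pts[OF H r] by (intro add_left_mono sum_mono) (clarify, blast)
  also have "\<dots> = 75 + card ?A3 * (25 + 75 * ?M)" by (simp add: case_prod_unfold)
  finally have "1 + card (jac_pts N H) \<le> 76 + card ?A3 * (25 + 75 * ?M)" by simp
  also have "\<dots> \<le> 76 * Q ^ 3 + Q ^ 3 * (25 + 75 * ?M)"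
    using A3 by (intro add_mono mult_mono) (auto simp: Q_def)
  also have "\<dots> \<le> 101 * Q ^ 3 * (1 + ?M)" by (simp add: algebra_simps)
  finally show ?thesis .
qed

text \<open>The constant satisfies \<open>166375 = 55\<^sup>3 \<ge> 164640\<close>: heights of this shape are stable under \<open>H \<mapsto> 55 H\<^bsup>2/3\<^esup>\<close>.\<close>
lemma card_jac_pts_iterate:
  fixes T :: real
  assumes N: "N \<noteq> 0" and T: "T \<ge> 1"
  defines "Q \<equiv> 25 * 3 ^ card (prime_factors (3 * N))"
  shows "1 + card (jac_pts N (166375 * T))
    \<le> (101 * Q ^ 3) ^ k * (1 + card (jac_pts N (166375 * T powr ((2/3) ^ k))))"
proof (induction k)
  case (Suc k)
  define X where "X = T powr ((2/3) ^ k)"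
  have X: "X \<ge> 1" using T by (simp add: X_def ge_one_powr_ge_zero)
  have X': "T powr ((2/3) ^ Suc k) = X powr (2/3)" by (simp add: X_def powr_powr mult.commute)
  have "(X powr (2/3)) ^ 3 = X powr (2/3 * real 3)" using X by (subst powr_power) simp_all
  also have "\<dots> = X\<^sup>2" using X by (simp add: powr_numeral)
  finally have cube: "(X powr (2/3)) ^ 3 = X\<^sup>2" .
  have "164640 * (166375 * X)\<^sup>2 = 164640 * 166375\<^sup>2 * X\<^sup>2" by (simp only: power_mult_distrib mult_ac)
  also have "\<dots> \<le> 166375 ^ 3 * X\<^sup>2" by (intro mult_right_mono) simp_all
  also have "\<dots> = (166375 * X powr (2/3)) ^ 3" by (simp only: power_mult_distrib cube)
  finally have r: "164640 * (166375 * X)\<^sup>2 \<le> (166375 * X powr (2/3)) ^ 3" .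
  have "1 + card (jac_pts N (166375 * X)) \<le> 101 * Q ^ 3 * (1 + card (jac_pts N (166375 * X powr (2/3))))"
    unfolding Q_def by (rule card_jac_pts_step[OF N _ _ r]) (use X in simp_all)
  then have "(101 * Q ^ 3) ^ k * (1 + card (jac_pts N (166375 * X)))
    \<le> (101 * Q ^ 3) ^ k * (101 * Q ^ 3 * (1 + card (jac_pts N (166375 * X powr (2/3)))))"
    by (rule mult_left_mono) simp
  also have "\<dots> = (101 * Q ^ 3) ^ Suc k * (1 + card (jac_pts N (166375 * X powr (2/3))))"
    by (simp only: power_Suc mult_ac)
  finally show ?case using Suc.IH unfolding X' X_def[symmetric] by linarith
qed (use T in simp)

text \<open>After \<open>k\<close> steps the trivial fourth-power bound is applied at height about
  T^((2/3)^k), which costs at most T^\<epsilon> once 4 (2/3)^k is at most \<epsilon>. Only then is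
  \<eta> chosen, so that the \<open>k\<close> class counts together cost a constant times
  |N|^\<epsilon>.\<close>

lemma card_jac_pts_le_powr:
  fixes \<epsilon> :: real
  assumes "\<epsilon> > 0"
  obtains C where "C > 0"
    and "\<And>N T. N \<noteq> 0 \<Longrightarrow> T \<ge> 1 \<Longrightarrow> real (card (jac_pts N T)) \<le> C * (eabs N * T) powr \<epsilon>"
proof -
  obtain k :: nat where "(2/3::real) ^ k < \<epsilon> / 4"
    using real_arch_pow_inv[of "\<epsilon> / 4" "2/3"] assms by auto
  then have k: "4 * (2/3::real) ^ k \<le> \<epsilon>" by simp
  \<comment> \<open>The shift to k + 1 keeps the denominator positive when k = 0.\<close>
  define \<eta> where "\<eta> = \<epsilon> / (3 * (real k + 1))"
  have eta: "\<eta> > 0" using assms by (simp add: \<eta>_def)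
  have "3 * \<eta> * real k \<le> \<epsilon>" using assms by (simp add: \<eta>_def field_simps)
  obtain K where K: "K \<ge> 1" "\<And>N::eis. N \<noteq> 0 \<Longrightarrow> 3 ^ card (prime_factors N) \<le> K * eabs N powr \<eta>"
    using three_power_prime_factors_le[OF eta] by blast
  define D where "D = 25 * K * 3 powr \<eta>"
  have D0: "D > 0" using K(1) by (simp add: D_def)
  define C where "C = (101 * D ^ 3) ^ k * 1000000 ^ 4"
  show thesis
  proof (rule that[of C])
    show "C > 0" using D0 by (simp add: C_def)
    fix N :: eis and T :: real assume N: "N \<noteq> 0" and T: "T \<ge> 1"
    define n where "n = eabs N"
    have n: "n \<ge> 1" using cmod_toC_ge_1[OF N] by (simp add: n_def)
    define Q :: nat where "Q = 25 * 3 ^ card (prime_factors (3 * N))"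
    have "real Q \<le> 25 * (K * eabs (3 * N) powr \<eta>)" using K(2)[of "3 * N"] N by (simp add: Q_def)
    also have "\<dots> = D * n powr \<eta>" by (simp add: D_def n_def norm_mult powr_mult)
    finally have Q: "real Q \<le> D * n powr \<eta>" .
    define X where "X = T powr ((2/3) ^ k)"
    have X: "X \<ge> 1" using T by (simp add: X_def ge_one_powr_ge_zero)
    have "real (card (jac_pts N T)) \<le> real (card (jac_pts N (166375 * T)))"
      using T by (intro of_nat_mono card_mono finite_jac_pts jac_pts_mono) auto
    also have "\<dots> \<le> real (1 + card (jac_pts N (166375 * T)))" by simp
    also have "\<dots> \<le> real ((101 * Q ^ 3) ^ k * (1 + card (jac_pts N (166375 * X))))"
      using card_jac_pts_iterate[OF N T, of k] unfolding Q_def X_def by (simp only: of_nat_le_iff)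
    also have "\<dots> = (101 * real Q ^ 3) ^ k * (1 + real (card (jac_pts N (166375 * X))))"
      by (simp only: of_nat_mult of_nat_power of_nat_add of_nat_1 of_nat_numeral)
    also have "\<dots> \<le> ((101 * D ^ 3) ^ k * n powr \<epsilon>) * (1000000 ^ 4 * T powr \<epsilon>)"
    proof (rule mult_mono)
      have "(101 * real Q ^ 3) ^ k \<le> (101 * (D * n powr \<eta>) ^ 3) ^ k"
        using Q by (intro power_mono mult_left_mono) auto
      also have "\<dots> = (101 * D ^ 3) ^ k * ((n powr \<eta>) ^ 3) ^ k"
        by (simp add: power_mult_distrib mult_ac)
      also have "((n powr \<eta>) ^ 3) ^ k = n powr (3 * \<eta> * real k)"
        using n by (simp add: powr_power mult_ac flip: power_mult)
      also have "\<dots> \<le> n powr \<epsilon>" using \<open>3 * \<eta> * real k \<le> \<epsilon>\<close> n by (rule powr_mono)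
      finally show "(101 * real Q ^ 3) ^ k \<le> (101 * D ^ 3) ^ k * n powr \<epsilon>"
        using D0 by (simp add: mult_left_mono)
      \<comment> \<open>665501 = 4 * 166375 + 1 absorbs the 1 because X is at least 1; the rounding
        up to 1000000 absorbs the remaining summand 1.\<close>
      have "real (card (jac_pts N (166375 * X))) \<le> (4 * (166375 * X) + 1) ^ 4"
        using X by (intro card_jac_pts) auto
      also have "\<dots> \<le> (665501 * X) ^ 4" using X by (intro power_mono) auto
      finally have "1 + real (card (jac_pts N (166375 * X))) \<le> 1 + 665501 ^ 4 * X ^ 4"
        by (simp only: power_mult_distrib)
      also have "\<dots> \<le> 1000000 ^ 4 * X ^ 4" using one_le_power[OF X, of 4] by simp
      also have "X ^ 4 = T powr (4 * (2/3) ^ k)"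
        using X T by (simp add: X_def powr_power mult.commute)
      also have "\<dots> \<le> T powr \<epsilon>" using k T by (rule powr_mono)
      finally show "1 + real (card (jac_pts N (166375 * X))) \<le> 1000000 ^ 4 * T powr \<epsilon>" by simp
    qed (use D0 in auto)
    also have "\<dots> = C * (eabs N * T) powr \<epsilon>"
      using T by (simp add: C_def n_def powr_mult)
    finally show "real (card (jac_pts N T)) \<le> C * (eabs N * T) powr \<epsilon>" .
  qed
qed

section \<open>Diagonal cubics over the integers\<close>

lemma cube_eq_iff:
  fixes x y :: "'a::linordered_idom"
  shows "x^3 = y^3 \<longleftrightarrow> x = y"
proof
  assume "x^3 = y^3"
  \<comment> \<open>4 (x^2 + x y + y^2) = (2 x + y)^2 + 3 y^2, which vanishes only for x = y =
    0.\<close>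
  then have "(x - y) * ((2 * x + y)\<^sup>2 + 3 * y\<^sup>2) = 0" by algebra
  then consider "x = y" | "(2 * x + y)\<^sup>2 + 3 * y\<^sup>2 = 0" by auto
  then show "x = y"
  proof cases
    case 2
    then have "y\<^sup>2 = 0" "(2 * x + y)\<^sup>2 = 0"
      using zero_le_power2[of y] zero_le_power2[of "2 * x + y"] by linarith+
    then show ?thesis by simp
  qed
qed simp

text \<open>A Bezout combination equal to 1 on the first vector takes on the second the value of the
  proportionality factor. By symmetry that factor is invertible in the integers.\<close>

lemma primitive_proportional:
  fixes x y z x' y' z' :: int
  assumes g: "gcd x (gcd y z) = 1" "gcd x' (gcd y' z') = 1"
    and "x * y' = x' * y" "x * z' = x' * z" "y * z' = y' * z"
  shows "(x', y', z') = (x, y, z) \<or> (x', y', z') = (- x, - y, - z)"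
proof -
  have bez: "\<exists>r s t. r * x + s * y + t * z = 1" if "gcd x (gcd y z) = 1" for x y z :: int
  proof -
    obtain u v where uv: "u * y + v * z = gcd y z" using bezout_int by blast
    obtain r w where "r * x + w * gcd y z = gcd x (gcd y z)" using bezout_int by blast
    then have "r * x + w * gcd y z = 1" using that by simp
    then have "r * x + (w * u) * y + (w * v) * z = 1" using uv by algebra
    then show ?thesis by blast
  qed
  obtain r s t where b1: "r * x + s * y + t * z = 1" using bez[OF g(1)] by blast
  obtain r' s' t' where b2: "r' * x' + s' * y' + t' * z' = 1" using bez[OF g(2)] by blast
  define e where "e = r * x' + s * y' + t * z'"
  define f where "f = r' * x + s' * y + t' * z"
  have e: "x' = e * x" "y' = e * y" "z' = e * z" using b1 assms(3-5) unfolding e_def by algebra+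
  have "f * e = 1" using b2 unfolding f_def e by algebra
  then have "e = 1 \<or> e = -1" by (metis mult.commute zmult_eq_1_iff)
  then show ?thesis using e by auto
qed

definition sols :: "real \<Rightarrow> int \<Rightarrow> int \<Rightarrow> int \<Rightarrow> (int \<times> int \<times> int) set" where
  "sols B a b c = {(x, y, z). a * x ^ 3 + b * y ^ 3 + c * z ^ 3 = 0 \<and> gcd x (gcd y z) = 1 \<and>
      real_of_int (max \<bar>x\<bar> (max \<bar>y\<bar> \<bar>z\<bar>)) \<le> B}"

lemma sols_bounds:
  assumes "(x, y, z) \<in> sols B a b c"
  shows "\<bar>real_of_int x\<bar> \<le> B" "\<bar>real_of_int y\<bar> \<le> B" "\<bar>real_of_int z\<bar> \<le> B"
  using assms by (auto simp: sols_def)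

lemma finite_sols: "finite (sols B a b c)"
proof (rule finite_subset)
  show "sols B a b c \<subseteq> {-\<lfloor>B\<rfloor>..\<lfloor>B\<rfloor>} \<times> {-\<lfloor>B\<rfloor>..\<lfloor>B\<rfloor>} \<times> {-\<lfloor>B\<rfloor>..\<lfloor>B\<rfloor>}"
  proof
    fix P assume P: "P \<in> sols B a b c"
    obtain x y z where xyz: "P = (x, y, z)" by (rule prod_cases3)
    from sols_bounds[OF P[unfolded xyz]] have "\<bar>x\<bar> \<le> \<lfloor>B\<rfloor>" "\<bar>y\<bar> \<le> \<lfloor>B\<rfloor>" "\<bar>z\<bar> \<le> \<lfloor>B\<rfloor>"
      by (simp_all add: le_floor_iff)
    then show "P \<in> {-\<lfloor>B\<rfloor>..\<lfloor>B\<rfloor>} \<times> {-\<lfloor>B\<rfloor>..\<lfloor>B\<rfloor>} \<times> {-\<lfloor>B\<rfloor>..\<lfloor>B\<rfloor>}"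
      unfolding xyz by auto
  qed
qed simp

text \<open>The three terms of the equation sum to zero, so the ratio of two determines all ratios.
  Integer cube roots are unique, and primitivity leaves only a sign.\<close>

lemma sols_proportional:
  assumes P: "(x, y, z) \<in> sols B a b c" and R: "(x', y', z') \<in> sols B a b c"
    and "a \<noteq> 0" "b \<noteq> 0" "c \<noteq> 0"
    and UV: "(a * x^3) * (b * y'^3) = (a * x'^3) * (b * y^3)"
  shows "(x', y', z') = (x, y, z) \<or> (x', y', z') = (- x, - y, - z)"
proof -
  have e: "a * x ^ 3 + b * y ^ 3 + c * z ^ 3 = 0" "a * x' ^ 3 + b * y' ^ 3 + c * z' ^ 3 = 0"
    using P R by (auto simp: sols_def)
  have "U * W' = U' * W \<and> V * W' = V' * W"
    if "U + V + W = 0" "U' + V' + W' = 0" "U * V' = U' * V" for U V W U' V' W' :: int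
    using that by algebra
  from this[OF e UV] have "a * b * ((x * y')^3 - (x' * y)^3) = 0"
    "a * c * ((x * z')^3 - (x' * z)^3) = 0" "b * c * ((y * z')^3 - (y' * z)^3) = 0"
    using UV by (simp_all add: power_mult_distrib algebra_simps)
  then have "x * y' = x' * y" "x * z' = x' * z" "y * z' = y' * z"
    using assms(3-5) by (auto simp: cube_eq_iff)
  then show ?thesis using P R by (intro primitive_proportional) (auto simp: sols_def)
qed

text \<open>The terms U, V, W of a solution sum to zero, so they are, up to a common factor,
  \<open>fU\<close>, \<open>fV\<close>, \<open>fW\<close> of some pair, whose sum of cubes is then
  \<open>a * b * c\<close> times a cube. The height is at most 2 * (2 B^6 * B^3). The pair recovers
  U : V and thus the solution up to sign, whence the factor 2.\<close>

lemma card_sols_le_jac_pts: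
  fixes a b c :: int
  assumes nz: "a \<noteq> 0" "b \<noteq> 0" "c \<noteq> 0" and B: "B \<ge> 1"
    and ab: "\<bar>real_of_int a\<bar> \<le> 2 * B ^ 6" "\<bar>real_of_int b\<bar> \<le> 2 * B ^ 6"
  shows "card (sols B a b c) \<le> 2 * card (jac_pts (of_int (a * b * c)) (4 * B ^ 9))"
proof -
  define J where "J = jac_pts (of_int (a * b * c)) (4 * B ^ 9)"
  have ex: "\<exists>p q g. (p, q) \<in> J \<and> of_int (b * y^3) - \<omega>^2 * of_int (a * x^3) = p * g \<and>
      \<omega> * of_int (a * x^3) - of_int (b * y^3) = q * g" if "(x, y, z) \<in> sols B a b c" for x y z
  proof -
    define U :: eis where "U = of_int (a * x^3)"
    define V :: eis where "V = of_int (b * y^3)"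
    define W :: eis where "W = of_int (c * z^3)"
    have e: "a * x^3 + b * y^3 + c * z^3 = 0" and g1: "gcd x (gcd y z) = 1"
      using that by (auto simp: sols_def)
    have "of_int (a * x^3 + b * y^3 + c * z^3) = (0::eis)" using e by simp
    then have UVW: "U + V + W = 0" by (simp add: U_def V_def W_def)
    have cubic: "\<bar>real_of_int (d * r^3)\<bar> \<le> 2 * B ^ 9"
      if "\<bar>real_of_int d\<bar> \<le> 2 * B ^ 6" "\<bar>real_of_int r\<bar> \<le> B" for d r
    proof -
      have "\<bar>real_of_int (d * r^3)\<bar> = \<bar>real_of_int d\<bar> * \<bar>real_of_int r\<bar> ^ 3"
        by (simp add: abs_mult power_abs)
      also have "\<dots> \<le> (2 * B ^ 6) * B ^ 3" using that B by (intro mult_mono power_mono) auto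
      also have "\<dots> = 2 * B ^ 9" by (simp flip: power_add)
      finally show ?thesis .
    qed
    have bUV: "eabs U \<le> 2 * B ^ 9" "eabs V \<le> 2 * B ^ 9"
      using cubic[OF ab(1) sols_bounds(1)[OF that]] cubic[OF ab(2) sols_bounds(2)[OF that]]
      unfolding U_def V_def toC_of_int norm_of_int by auto
    \<comment> \<open>Inverse of the linear map (p, q) to (fU, fV), with the determinant cleared:
      \<open>fU p0 q0\<close> is (\<omega> - \<omega>^2) U and \<open>fV p0 q0\<close> is (\<omega>
      - \<omega>^2) V.\<close>
    define p0 where "p0 = V - \<omega>^2 * U"
    define q0 where "q0 = \<omega> * U - V"
    have b0: "eabs p0 \<le> 4 * B ^ 9" "eabs q0 \<le> 4 * B ^ 9"
      using bUV norm_triangle_ineq4[of "toC V" "toC \<omega> ^ 2 * toC U"] norm_triangle_ineq4[of "toC \<omega> * toC U" "toC V"]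
      by (simp_all add: p0_def q0_def norm_mult norm_power eabs_omega)
    have "p0 \<noteq> 0 \<or> q0 \<noteq> 0"
    proof (rule ccontr)
      assume "\<not> (p0 \<noteq> 0 \<or> q0 \<noteq> 0)"
      then have "p0 = 0" "q0 = 0" by auto
      then have "(\<omega> - \<omega>^2) * U = 0" unfolding p0_def q0_def by algebra
      then have "U = 0" "V = 0" using omega_nontrivial \<open>p0 = 0\<close> by (auto simp: p0_def)
      moreover from this have "W = 0" using UVW by simp
      ultimately have "x = 0 \<and> y = 0 \<and> z = 0" using nz unfolding U_def V_def W_def by (simp only: of_int_eq_0_iff) simp
      then show False using g1 by simp
    qed
    then obtain p q g where pqg: "p0 = p * g" "q0 = q * g" "coprime p q" "g \<noteq> 0"
      using gcd_coprime_exists[of p0 q0] by (metis gcd_eq_0_iff)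
    have W: "W = - U - V" using UVW by algebra
    have "(p^3 + q^3) * g^3 = p0^3 + q0^3" by (simp add: pqg power_mult_distrib algebra_simps)
    also have "\<dots> = (\<omega> - \<omega>^2)^3 * (U * V * W)"
      using omega_square unfolding p0_def q0_def W by algebra
    also have "U * V * W = of_int (a * b * c) * of_int (x * y * z)^3"
      by (simp add: U_def V_def W_def power_mult_distrib mult_ac)
    finally have "(p^3 + q^3) * g^3 = of_int (a * b * c) * ((\<omega> - \<omega>^2) * of_int (x * y * z))^3"
      by (simp only: power_mult_distrib mult_ac)
    moreover have "eabs p \<le> eabs p0 \<and> eabs q \<le> eabs q0"
      using cmod_toC_ge_1[OF pqg(4)] by (simp add: pqg(1,2) norm_mult mult_le_cancel_left1)
    ultimately have "(p, q) \<in> J" using pqg(3,4) b0 unfolding J_def jac_pts_def by force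
    then show ?thesis using pqg(1,2) unfolding p0_def q0_def U_def V_def by blast
  qed
  let ?R = "\<lambda>P S. \<exists>g. of_int (b * (fst (snd P))^3) - \<omega>^2 * of_int (a * (fst P)^3) = fst S * g \<and>
      \<omega> * of_int (a * (fst P)^3) - of_int (b * (fst (snd P))^3) = snd S * g"
  have finJ: "finite J" unfolding J_def using B by (intro finite_jac_pts) simp
  have fib: "card {P \<in> sols B a b c. ?R P S} \<le> 2" for S
  proof (cases "{P \<in> sols B a b c. ?R P S} = {}")
    case False
    then obtain x y z g where P: "(x, y, z) \<in> sols B a b c"
      "of_int (b * y^3) - \<omega>^2 * of_int (a * x^3) = fst S * g"
      "\<omega> * of_int (a * x^3) - of_int (b * y^3) = snd S * g" by auto
    have lift: "(\<omega> - \<omega>^2) * U = (fst S + snd S) * g"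
      "(\<omega> - \<omega>^2) * V = (\<omega> * fst S + \<omega>^2 * snd S) * g"
      if "V - \<omega>^2 * U = fst S * g" "\<omega> * U - V = snd S * g" for U V g
      using that omega_square by algebra+
    have "P' \<in> {(x, y, z), (- x, - y, - z)}" if P': "P' \<in> sols B a b c" "?R P' S" for P'
    proof -
      obtain x' y' z' where xyz': "P' = (x', y', z')" by (rule prod_cases3)
      obtain g' where g': "of_int (b * y'^3) - \<omega>^2 * of_int (a * x'^3) = fst S * g'"
        "\<omega> * of_int (a * x'^3) - of_int (b * y'^3) = snd S * g'"
        using P'(2) unfolding xyz' by auto
      have "((\<omega> - \<omega>^2) * of_int (a * x^3)) * ((\<omega> - \<omega>^2) * of_int (b * y'^3)) =
          ((\<omega> - \<omega>^2) * of_int (a * x'^3)) * ((\<omega> - \<omega>^2) * of_int (b * y^3))"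
        unfolding lift[OF P(2,3)] lift[OF g'] by (simp only: mult_ac)
      then have "(\<omega> - \<omega>^2)^2 * of_int ((a * x^3) * (b * y'^3)) =
          (\<omega> - \<omega>^2)^2 * of_int ((a * x'^3) * (b * y^3))"
        by (simp only: of_int_mult power2_eq_square mult_ac)
      then have "(of_int ((a * x^3) * (b * y'^3)) :: eis) = of_int ((a * x'^3) * (b * y^3))"
        using omega_nontrivial by (metis mult_cancel_left power_eq_0_iff)
      then have "(a * x^3) * (b * y'^3) = (a * x'^3) * (b * y^3)" by (simp only: of_int_eq_iff)
      from sols_proportional[OF P(1) P'(1)[unfolded xyz'] nz this] show ?thesis
        unfolding xyz' by auto
    qed
    then have "{P \<in> sols B a b c. ?R P S} \<subseteq> {(x, y, z), (- x, - y, - z)}" by blast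
    from card_mono[OF _ this] show ?thesis
      by (rule order_trans) (simp_all add: card_insert_if)
  next
    case True
    then show ?thesis by (simp only: card.empty)
  qed
  have "sols B a b c \<subseteq> (\<Union>S\<in>J. {P \<in> sols B a b c. ?R P S})"
    using ex by force
  then have "card (sols B a b c) \<le> card (\<Union>S\<in>J. {P \<in> sols B a b c. ?R P S})"
    using finJ finite_sols by (intro card_mono) auto
  also have "\<dots> \<le> (\<Sum>S\<in>J. card {P \<in> sols B a b c. ?R P S})" by (rule card_UN_le[OF finJ])
  also have "\<dots> \<le> (\<Sum>S\<in>J. 2)" by (rule sum_mono) (rule fib)
  finally show ?thesis by (simp add: J_def)
qed

text \<open>
  Two non-proportional solutions determine the curve, whose coefficients may therefore be replaced
  by the cross product of the vectors of cubes.
\<close>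
lemma coefficient_reduction:
  fixes a b c :: int
  assumes nz: "a \<noteq> 0" "b \<noteq> 0" "c \<noteq> 0" and B: "B \<ge> 1" and "card (sols B a b c) > 2"
  obtains a' b' c' where "a' \<noteq> 0" "b' \<noteq> 0" "c' \<noteq> 0" "sols B a b c \<subseteq> sols B a' b' c'"
    and "\<bar>real_of_int a'\<bar> \<le> 2 * B ^ 6" "\<bar>real_of_int b'\<bar> \<le> 2 * B ^ 6" "\<bar>real_of_int c'\<bar> \<le> 2 * B ^ 6"
proof -
  obtain x y z where P: "(x, y, z) \<in> sols B a b c"
    using assms(5) by (metis card.empty ex_in_conv not_less_zero prod_cases3)
  have "\<not> sols B a b c \<subseteq> {(x, y, z), (- x, - y, - z)}"
  proof
    assume "sols B a b c \<subseteq> {(x, y, z), (- x, - y, - z)}"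
    from card_mono[OF _ this] have "card (sols B a b c) \<le> 2"
      by (rule order_trans) (simp_all add: card_insert_if)
    then show False using assms(5) by simp
  qed
  then obtain x' y' z' where R: "(x', y', z') \<in> sols B a b c"
    and ne: "(x', y', z') \<noteq> (x, y, z)" "(x', y', z') \<noteq> (- x, - y, - z)" by auto
  define a' where "a' = y^3 * z'^3 - z^3 * y'^3"
  define b' where "b' = z^3 * x'^3 - x^3 * z'^3"
  define c' where "c' = x^3 * y'^3 - y^3 * x'^3"
  have e: "a * x ^ 3 + b * y ^ 3 + c * z ^ 3 = 0" "a * x' ^ 3 + b * y' ^ 3 + c * z' ^ 3 = 0"
    using P R by (auto simp: sols_def)
  have r: "a * b' = b * a'" "a * c' = c * a'" "b * c' = c * b'"
    unfolding a'_def b'_def c'_def using e by algebra+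
  \<comment> \<open>Otherwise the two solutions would agree up to sign. The proportionality
    \<open>r\<close> then makes the other two coefficients nonzero.\<close>
  have "c' \<noteq> 0"
  proof
    assume "c' = 0"
    then have "(a * x^3) * (b * y'^3) = (a * x'^3) * (b * y^3)" unfolding c'_def by algebra
    from sols_proportional[OF P R nz this] show False using ne by blast
  qed
  then have nz': "a' \<noteq> 0" "b' \<noteq> 0" "c' \<noteq> 0" using r nz by auto
  have sub: "sols B a b c \<subseteq> sols B a' b' c'"
  proof clarify
    fix X Y Z assume S: "(X, Y, Z) \<in> sols B a b c"
    then have "a * X^3 + b * Y^3 + c * Z^3 = 0" by (simp add: sols_def)
    then have "a * (a' * X^3 + b' * Y^3 + c' * Z^3) = 0" using r by algebra
    then show "(X, Y, Z) \<in> sols B a' b' c'" using S nz by (auto simp: sols_def)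
  qed
  have bd: "\<bar>real_of_int (r^3 * s^3 - t^3 * u^3)\<bar> \<le> 2 * B ^ 6"
    if "\<bar>real_of_int r\<bar> \<le> B" "\<bar>real_of_int s\<bar> \<le> B" "\<bar>real_of_int t\<bar> \<le> B" "\<bar>real_of_int u\<bar> \<le> B"
    for r s t u
  proof -
    have m: "\<bar>real_of_int r ^ 3 * real_of_int s ^ 3\<bar> \<le> B ^ 6"
      if "\<bar>real_of_int r\<bar> \<le> B" "\<bar>real_of_int s\<bar> \<le> B" for r s
    proof -
      have "\<bar>real_of_int r ^ 3 * real_of_int s ^ 3\<bar> = \<bar>real_of_int r\<bar> ^ 3 * \<bar>real_of_int s\<bar> ^ 3"
        by (simp add: abs_mult power_abs)
      also have "\<dots> \<le> B ^ 3 * B ^ 3" using that B by (intro mult_mono power_mono) auto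
      finally show ?thesis by (simp flip: power_add)
    qed
    show ?thesis using m[OF that(1,2)] m[OF that(3,4)] by simp
  qed
  show thesis
    by (rule that[OF nz' sub]) (use sols_bounds[OF P] sols_bounds[OF R] bd in \<open>simp_all only: a'_def b'_def c'_def\<close>)
qed

theorem theorem3:
  "\<forall>\<epsilon>::real. \<epsilon> > 0 \<longrightarrow>
     (\<exists>C::real. \<forall>a b c :: int. \<forall>B::real.
        a \<noteq> 0 \<longrightarrow> b \<noteq> 0 \<longrightarrow> c \<noteq> 0 \<longrightarrow> B \<ge> 1 \<longrightarrow>
        real (rho B a b c) \<le> C * B powr \<epsilon>)"
proof (intro allI impI)
  fix \<epsilon> :: real assume "\<epsilon> > 0"
  then obtain C where C: "C > 0" "\<And>N T. N \<noteq> 0 \<Longrightarrow> T \<ge> 1 \<Longrightarrow>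
      real (card (jac_pts N T)) \<le> C * (eabs N * T) powr (\<epsilon> / 27)"
    using card_jac_pts_le_powr[of "\<epsilon> / 27"] by auto
  \<comment> \<open>After reduction |N| is at most 8 B^18 and the height is 4 B^9, so their product
    is at most 32 B^27, which explains the exponent \<epsilon> / 27. The summand 2 covers curves
    with at most two solutions, where no reduction of the coefficients is available.\<close>
  define D where "D = 2 + 2 * C * 32 powr (\<epsilon> / 27)"
  have "real (rho B a b c) \<le> D * B powr \<epsilon>"
    if nz: "a \<noteq> 0" "b \<noteq> 0" "c \<noteq> 0" and B: "B \<ge> 1" for a b c B
  proof -
    have rho: "rho B a b c = card (sols B a b c)" unfolding rho_def sols_def ..
    have B1: "B powr \<epsilon> \<ge> 1" using B \<open>\<epsilon> > 0\<close> by (simp add: ge_one_powr_ge_zero)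
    show ?thesis
    proof (cases "card (sols B a b c) > 2")
      case False
      then have "real (rho B a b c) \<le> 2 * 1" unfolding rho by simp
      also have "\<dots> \<le> D * B powr \<epsilon>" using B1 C(1) by (intro mult_mono) (auto simp: D_def)
      finally show ?thesis .
    next
      case True
      obtain a' b' c' where abc: "a' \<noteq> 0" "b' \<noteq> 0" "c' \<noteq> 0" "sols B a b c \<subseteq> sols B a' b' c'"
        "\<bar>real_of_int a'\<bar> \<le> 2 * B ^ 6" "\<bar>real_of_int b'\<bar> \<le> 2 * B ^ 6" "\<bar>real_of_int c'\<bar> \<le> 2 * B ^ 6"
        by (rule coefficient_reduction[OF nz B True])
      define N :: eis where "N = of_int (a' * b' * c')"
      have N: "N \<noteq> 0" using abc(1-3) unfolding N_def by (simp only: of_int_eq_0_iff) simp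
      have "eabs N = \<bar>real_of_int a'\<bar> * \<bar>real_of_int b'\<bar> * \<bar>real_of_int c'\<bar>"
        unfolding N_def toC_of_int norm_of_int by (simp add: abs_mult)
      also have "\<dots> \<le> (2 * B ^ 6) * (2 * B ^ 6) * (2 * B ^ 6)"
        using abc(5-7) B by (intro mult_mono) auto
      finally have "eabs N * (4 * B ^ 9) \<le> ((2 * B ^ 6) * (2 * B ^ 6) * (2 * B ^ 6)) * (4 * B ^ 9)"
        using B by (intro mult_right_mono) auto
      also have "\<dots> = 32 * B ^ 27" by (simp flip: power_add add: mult_ac)
      finally have NT: "eabs N * (4 * B ^ 9) \<le> 32 * B ^ 27" .
      have T: "4 * B ^ 9 \<ge> 1" using one_le_power[OF B, of 9] by simp
      have "rho B a b c \<le> card (sols B a' b' c')"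
        unfolding rho using abc(4) by (intro card_mono finite_sols)
      also have "\<dots> \<le> 2 * card (jac_pts N (4 * B ^ 9))"
        unfolding N_def by (rule card_sols_le_jac_pts[OF abc(1-3) B abc(5,6)])
      finally have "real (rho B a b c) \<le> 2 * real (card (jac_pts N (4 * B ^ 9)))" by linarith
      also have "\<dots> \<le> 2 * (C * (eabs N * (4 * B ^ 9)) powr (\<epsilon> / 27))"
        using C(2)[OF N T] by simp
      also have "\<dots> \<le> 2 * (C * (32 * B ^ 27) powr (\<epsilon> / 27))"
        using NT C(1) B \<open>\<epsilon> > 0\<close> by (intro mult_left_mono powr_mono2) auto
      also have "(32 * B ^ 27) powr (\<epsilon> / 27) = 32 powr (\<epsilon> / 27) * B powr \<epsilon>"
      proof -
        have "B ^ 27 = B powr 27" using B powr_realpow[of B 27] by simp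
        then show ?thesis using B by (simp only: powr_mult powr_powr) simp
      qed
      also have "2 * (C * (32 powr (\<epsilon> / 27) * B powr \<epsilon>)) \<le> D * B powr \<epsilon>"
        by (simp add: D_def algebra_simps)
      finally show ?thesis .
    qed
  qed
  then show "\<exists>C. \<forall>a b c B. a \<noteq> 0 \<longrightarrow> b \<noteq> 0 \<longrightarrow> c \<noteq> 0 \<longrightarrow> B \<ge> 1 \<longrightarrow> real (rho B a b c) \<le> C * B powr \<epsilon>"
    by blast
qed

end
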